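(* Let $G=(V,E,\Gamma)$ be a connected weighted graph with nonzero real edge weights $\Gamma=\{\gamma_e\}_{e\in E}$, let $\mathcal{L}_G$ be its Laplacian matrix, let $C=|E|-|V|+1$, and let $\mathcal{Z}_G$ be its cycle intersection matrix formed from a basis of the cycle space. Then: (1) The number of positive eigenvalues of the Laplacian is the number of negative edges minus the number of positive eigenvalues of the cycle intersection matrix: $$n_+(\mathcal{L}_G)=\#\{e\in E : \gamma_e<0\}-n_+(\mathcal{Z}_G),$$ and the index of $\mathcal{Z}_G$ does not depend on the choice of basis of the cycle space. (2) In particular, $n_+(\mathcal{L}_G)\ \ge\ \#\{e\in \mathrm{Tree}(G) : \gamma_e<0\}$. (3) The maximal number of negative edges a graph can have and still have a stable Laplacian is the cycle number $C$. (4) If $\mathcal{L}_G$ is stable and $G$ has exactly $C$ negative edges, then there is a choice of basis cycles such that there is exactly one negative edge in each cycle in the basis; in other words, the graph obtained from $G$ by removing the negative edges must be a tree.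
   Context: A weighted graph $G=(V,E,\Gamma)$ is a finite, simple, undirected graph with real edge weights $\gamma_e$, $e\in E$. Its Laplacian matrix is the symmetric $|V|\times|V|$ matrix with off-diagonal entries $(\mathcal{L}_G)_{v,w}=\gamma_{(v,w)}$ ($=0$ if $v,w$ are not adjacent) and diagonal entries $(\mathcal{L}_G)_{v,v}=-\sum_{u}\gamma_{(v,u)}$ (this is the negative of the usual sign convention). For a real symmetric matrix $M$, $n_+(M)$ is the number of positive eigenvalues counted with multiplicity; the index of $M$ is the triple of numbers of positive, zero and negative eigenvalues. $\mathcal{L}_G$ is called stable if $n_+(\mathcal{L}_G)=0$. An edge $e$ is negative if $\gamma_e<0$. Fix an orientation of each edge. The signed incidence matrix $B_G$ is the $|V|\times|E|$ matrix with $(B_G)_{v,e}=1$ if $e=(v,\ast)$, $-1$ if $e=(\ast,v)$, and $0$ otherwise. The cycle space is the nullspace of $B_G$ in $\mathbb{R}^{E}$; for connected $G$ its dimension is $C=|E|-|V|+1$. Given a basis $y_1,\dots,y_C$ of the cycle space, let $Y_G$ be the $|E|\times C$ matrix with columns $y_i$ and $D_G=\mathrm{diag}(\gamma_e)_{e\in E}$. The cycle intersection matrix is the $C\times C$ matrix $\mathcal{Z}_G=-Y_G^\top D_G^{-1}Y_G$, i.e. $(\mathcal{Z}_G)_{ij}=-\sum_{e\in E}\gamma_e^{-1}y_{i,e}y_{j,e}$. $\mathrm{Tree}(G)$ is the set of edges of $G$ contained in every spanning tree of $G$ (equivalently, edges in no cycle). Cycles of $G$ are regarded as elements of the cycle space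 via their signed indicator vectors (entry $+1$ or $-1$ at edges of the cycle traversed along or against their orientation, $0$ elsewhere).
   Formalization: In (1) the printed identity fails when Z_G is singular (triangle with weights 1, 1, -1/2); it is replaced by n_+(L_G) = #{negative edges} - n_+(Z_G) - n_0(Z_G), with n_0 the multiplicity of eigenvalue 0, so the printed formula is claimed only when n_0(Z_G) = 0. *)

theory Defs
  imports "Jordan_Normal_Form.Matrix_Kernel" "Jordan_Normal_Form.Char_Poly"
begin

section \<open>Undirected simple graphs\<close>

text \<open>
  The notions \<open>forest\<close> and \<open>tree\<close> of the AFP entry \<open>Graph_Theory\<close> forbid only directed cycles (and on
  symmetric digraphs forbid every edge), so the undirected notions are defined here. A graph is a
  vertex set together with a set of two-element edges.
\<close>

definition simple_graph :: "'v set \<Rightarrow> 'v set set \<Rightarrow> bool" where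
  "simple_graph V E \<longleftrightarrow> finite V \<and> (\<forall>e\<in>E. e \<subseteq> V \<and> card e = 2)"

definition graph_connected :: "'v set \<Rightarrow> 'v set set \<Rightarrow> bool" where
  "graph_connected V E \<longleftrightarrow> V \<noteq> {} \<and> (\<forall>u\<in>V. \<forall>v\<in>V. (u, v) \<in> {(x, y). {x, y} \<in> E}\<^sup>*)"

text \<open>A cycle is given by its cyclic sequence of distinct vertices, which also fixes the direction
  in which it is traversed.\<close>

definition cycle_arcs :: "'v list \<Rightarrow> ('v \<times> 'v) set" where
  "cycle_arcs c = set (zip c (rotate1 c))"

definition cycle_edges :: "'v list \<Rightarrow> 'v set set" where
  "cycle_edges c = (\<lambda>(u, v). {u, v}) ` cycle_arcs c"

definition graph_cycle :: "'v set \<Rightarrow> 'v set set \<Rightarrow> 'v list \<Rightarrow> bool" where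
  "graph_cycle V E c \<longleftrightarrow> 3 \<le> length c \<and> distinct c \<and> set c \<subseteq> V \<and> cycle_edges c \<subseteq> E"

definition graph_tree :: "'v set \<Rightarrow> 'v set set \<Rightarrow> bool" where
  "graph_tree V E \<longleftrightarrow> graph_connected V E \<and> (\<nexists>c. graph_cycle V E c)"

definition spanning_tree_edges :: "'v set \<Rightarrow> 'v set set \<Rightarrow> 'v set set \<Rightarrow> bool" where
  "spanning_tree_edges V E T \<longleftrightarrow> T \<subseteq> E \<and> graph_tree V T"

definition Tree_edges :: "'v set \<Rightarrow> 'v set set \<Rightarrow> 'v set set" where
  "Tree_edges V E = {e \<in> E. \<forall>T. spanning_tree_edges V E T \<longrightarrow> e \<in> T}"

text \<open>The cycle number \<open>|E| - |V| + 1\<close>; the truncated subtraction on \<^typ>\<open>nat\<close> is exact for connected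
  graphs, which satisfy \<open>|V| \<le> |E| + 1\<close>.\<close>

definition cycle_number :: "'v set \<Rightarrow> 'v set set \<Rightarrow> nat" where
  "cycle_number V E = card E + 1 - card V"

definition negative_edges :: "'v set set \<Rightarrow> ('v set \<Rightarrow> real) \<Rightarrow> 'v set set" where
  "negative_edges E \<gamma> = {e \<in> E. \<gamma> e < 0}"

text \<open>An orientation maps an edge \<open>{u, v}\<close> to either \<open>(u, v)\<close> or \<open>(v, u)\<close>.\<close>

definition orientation :: "'v set set \<Rightarrow> ('v set \<Rightarrow> 'v \<times> 'v) \<Rightarrow> bool" where
  "orientation E ori \<longleftrightarrow> (\<forall>e\<in>E. e = {fst (ori e), snd (ori e)})"

text \<open>A list enumerating a finite set, used to index the rows and columns of matrices.\<close>

definition enumerates :: "'a list \<Rightarrow> 'a set \<Rightarrow> bool" where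
  "enumerates xs A \<longleftrightarrow> distinct xs \<and> set xs = A"


section \<open>Index of a matrix\<close>

text \<open>Eigenvalues are counted with their multiplicity as roots of the characteristic polynomial.\<close>

definition eigenvalue_count :: "(real \<Rightarrow> bool) \<Rightarrow> real mat \<Rightarrow> nat" where
  "eigenvalue_count P M = (\<Sum>a | eigenvalue M a \<and> P a. Polynomial.order a (char_poly M))"

definition n_pos :: "real mat \<Rightarrow> nat" where
  "n_pos M = eigenvalue_count (\<lambda>a. a > 0) M"

definition n_zero :: "real mat \<Rightarrow> nat" where
  "n_zero M = eigenvalue_count (\<lambda>a. a = 0) M"

definition n_neg :: "real mat \<Rightarrow> nat" where
  "n_neg M = eigenvalue_count (\<lambda>a. a < 0) M"

definition mat_index :: "real mat \<Rightarrow> nat \<times> nat \<times> nat" where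
  "mat_index M = (n_pos M, n_zero M, n_neg M)"


section \<open>Matrices of a weighted graph\<close>

text \<open>Sign convention: positive weights give a negative semidefinite Laplacian.\<close>

definition laplacian :: "'v list \<Rightarrow> 'v set set \<Rightarrow> ('v set \<Rightarrow> real) \<Rightarrow> real mat" where
  "laplacian vs E \<gamma> = mat (length vs) (length vs) (\<lambda>(i, j).
     if i = j then - (\<Sum>u | {vs ! i, u} \<in> E. \<gamma> {vs ! i, u})
     else if {vs ! i, vs ! j} \<in> E then \<gamma> {vs ! i, vs ! j} else 0)"

definition laplacian_stable :: "'v list \<Rightarrow> 'v set set \<Rightarrow> ('v set \<Rightarrow> real) \<Rightarrow> bool" where
  "laplacian_stable vs E \<gamma> \<longleftrightarrow> n_pos (laplacian vs E \<gamma>) = 0"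

definition incidence_matrix :: "'v list \<Rightarrow> 'v set list \<Rightarrow> ('v set \<Rightarrow> 'v \<times> 'v) \<Rightarrow> real mat" where
  "incidence_matrix vs es ori = mat (length vs) (length es) (\<lambda>(i, k).
     if vs ! i = fst (ori (es ! k)) then 1
     else if vs ! i = snd (ori (es ! k)) then - 1 else 0)"

definition cycle_space_basis ::
  "'v list \<Rightarrow> 'v set list \<Rightarrow> ('v set \<Rightarrow> 'v \<times> 'v) \<Rightarrow> real vec list \<Rightarrow> bool" where
  "cycle_space_basis vs es ori ys \<longleftrightarrow>
     distinct ys \<and> kernel.basis (length es) (incidence_matrix vs es ori) (set ys)"

text \<open>
  The matrix \<open>Z = - Y\<^sup>T D\<^sup>-\<^sup>1 Y\<close> may be singular, and then \<open>n_pos L\<close> is not the number of negative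
  edges minus \<open>n_pos Z\<close>: on the triangle with weights \<open>1, 1, -1/2\<close> and basis vector \<open>(1, 1, -1)\<close>, \<open>Z\<close>
  is the zero matrix and \<open>L = - 1/2 u u\<^sup>T\<close> with \<open>u = (1, -2, 1)\<close>, so \<open>n_pos L = n_pos Z = 0\<close> although
  there is one negative edge. In general \<open>n_zero Z\<close> has to be subtracted as well.
\<close>

definition cycle_intersection_matrix ::
  "'v set list \<Rightarrow> ('v set \<Rightarrow> real) \<Rightarrow> real vec list \<Rightarrow> real mat" where
  "cycle_intersection_matrix es \<gamma> ys =
     (let Y = mat_of_cols (length es) ys;
          D_inv = mat_diag (length es) (\<lambda>k. inverse (\<gamma> (es ! k)))
      in - (transpose_mat Y * D_inv * Y))"

definition cycle_vector :: "'v set list \<Rightarrow> ('v set \<Rightarrow> 'v \<times> 'v) \<Rightarrow> 'v list \<Rightarrow> real vec" where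
  "cycle_vector es ori c = vec (length es) (\<lambda>k.
     if ori (es ! k) \<in> cycle_arcs c then 1
     else if prod.swap (ori (es ! k)) \<in> cycle_arcs c then - 1 else 0)"

end

theory Submission
  imports Defs
begin

text \<open>
  Write \<open>grad w\<close> for the function \<open>e = (u, v) \<mapsto> w u - w v\<close> on oriented edges. On \<open>\<real>\<^sup>E\<close> take the
  nondegenerate form \<open>\<Sum>e. \<gamma> e * (x e)\<^sup>2\<close>, whose negative index is the number of negative edges. The
  Laplacian is minus its restriction to the gradients, and \<open>Z\<close> is minus its restriction to the
  vectors \<open>X e / \<gamma> e\<close> with \<open>X\<close> in the cycle space. These two subspaces are orthogonal complements
  for the form, and their intersection is the radical of both restrictions, of dimension \<open>n_zero Z\<close>.
  Hence the negative index of the form is \<open>n_pos L + n_pos Z + n_zero Z\<close>; both inequalities come from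
  solving a homogeneous linear system with more unknowns than equations. The remaining claims follow by
  testing the form on cut functions: a bridge yields \<open>w\<close> with \<open>grad w\<close> supported on that bridge, and if the
  positive edges did not connect \<open>V\<close>, some nonzero \<open>grad w\<close> would be supported on negative edges.
\<close>

section \<open>Spectral theorem for real symmetric matrices and inertia\<close>

text \<open>When \<open>Z\<close> is singular the two subspaces intersect, so R^E is not their
  direct sum and the indices of the two restrictions cannot simply be added. The proof therefore
  works with pairs \<open>(c, g)\<close> of coordinates in eigenbases of \<open>L\<close> and of
  \<open>Z\<close>. The vector \<open>grad w + X / \<gamma>\<close> that they describe has form
  value minus the sum of \<open>d c^2\<close> minus the sum of \<open>f g^2\<close>, even though
  different pairs may describe the same vector. What matters is where zero eigenvalues go: those of
  \<open>Z\<close> are counted with the positive ones, those of \<open>L\<close> with the negative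
  ones. With this choice a solution of either linear system makes the form both nonnegative and
  nonpositive, so it vanishes term by term, and injectivity of the coordinates removes what is left.
  The extra one in |V| + C = |E| + 1 is the constant function, which has zero gradient.

  Existence in (3) needs a separate construction: a spanning tree gets a heavy weight and every
  other edge weight -1, since each gradient value is bounded by the gradients along the
  tree.\<close>

lemma symmetric_real_eigenvector_exists:
  fixes A :: "real mat"
  assumes A: "A \<in> carrier_mat n n" and sym: "transpose_mat A = A" and n: "0 < n"
  shows "\<exists>a v. v \<in> carrier_vec n \<and> v \<noteq> 0\<^sub>v n \<and> A *\<^sub>v v = a \<cdot>\<^sub>v v"
proof -
  let ?C = "map_mat complex_of_real A"
  have C: "?C \<in> carrier_mat n n" using A by simp
  obtain as where as: "char_poly ?C = (\<Prod>a\<leftarrow>as. [:- a, 1:])" and len: "length as = n"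
    using char_poly_factorized[OF C] by auto
  obtain z where z: "z \<in> set as" using len n by (cases as) auto
  have "poly (char_poly ?C) z = 0"
    unfolding as poly_prod_list using z by (auto simp: prod_list_zero_iff)
  then have root: "eigenvalue ?C z" using eigenvalue_root_char_poly[OF C] by simp
  then obtain v where v: "v \<in> carrier_vec n" "v \<noteq> 0\<^sub>v n" and ev: "?C *\<^sub>v v = z \<cdot>\<^sub>v v"
    using C unfolding eigenvalue_def eigenvector_def by auto
  have sym': "A $$ (i, j) = A $$ (j, i)" if "i < n" "j < n" for i j
    using sym that A by (metis carrier_matD index_transpose_mat(1))
  have ev': "(\<Sum>j<n. complex_of_real (A $$ (i, j)) * v $ j) = z * v $ i" if "i < n" for i
  proof -
    have "(?C *\<^sub>v v) $ i = z * v $ i" using ev that v by simp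
    then show ?thesis using that A v by (simp add: scalar_prod_def atLeast0LessThan)
  qed
  \<comment> \<open>The Hermitian form of \<open>A\<close> at \<open>v\<close>: symmetry makes it
    equal to its conjugate, and the eigenvector equation makes it \<open>z\<close> times a positive
    number, so \<open>z\<close> is real.\<close>
  define S where "S = (\<Sum>i<n. \<Sum>j<n. cnj (v $ i) * (complex_of_real (A $$ (i, j)) * v $ j))"
  have S1: "S = z * (\<Sum>i<n. of_real ((cmod (v $ i))\<^sup>2))"
  proof -
    have "S = (\<Sum>i<n. cnj (v $ i) * (z * v $ i))"
      unfolding S_def sum_distrib_left[symmetric] using ev' by simp
    then show ?thesis
      unfolding sum_distrib_left complex_norm_square by (simp add: mult_ac)
  qed
  have "cnj S = (\<Sum>i<n. \<Sum>j<n. v $ i * (complex_of_real (A $$ (i, j)) * cnj (v $ j)))"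
    unfolding S_def by simp
  also have "\<dots> = (\<Sum>j<n. \<Sum>i<n. v $ i * (complex_of_real (A $$ (i, j)) * cnj (v $ j)))"
    by (rule sum.swap)
  also have "\<dots> = S"
    unfolding S_def by (intro sum.cong refl) (simp add: sym')
  finally have "cnj S = S" .
  then have "Im S = 0" by (simp add: complex_eq_iff)
  moreover have "Im S = Im z * (\<Sum>i<n. (cmod (v $ i))\<^sup>2)"
    unfolding S1 of_real_sum[symmetric] by simp
  moreover obtain i where i: "i < n" "v $ i \<noteq> 0" using v by (metis eq_vecI carrier_vecD index_zero_vec)
  then have "(\<Sum>i<n. (cmod (v $ i))\<^sup>2) \<noteq> 0"
    by (subst sum_nonneg_eq_0_iff) auto
  ultimately have "z = complex_of_real (Re z)" by (simp add: complex_eq_iff)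
  moreover have "poly (map_poly complex_of_real (char_poly A)) z = 0"
    using root eigenvalue_root_char_poly[OF C] of_real_hom.char_poly_hom[OF A] by metis
  ultimately have "complex_of_real (poly (char_poly A) (Re z)) = 0"
    by (metis of_real_hom.poly_map_poly)
  then have "eigenvalue A (Re z)" using eigenvalue_root_char_poly[OF A] by simp
  then show ?thesis using A unfolding eigenvalue_def eigenvector_def by auto
qed

text \<open>The matrix is the Householder reflection exchanging \<open>v\<close> with the first unit vector.\<close>

lemma orthogonal_mat_with_first_col:
  fixes v :: "real vec"
  assumes v: "v \<in> carrier_vec n" and n: "0 < n" and norm: "v \<bullet> v = 1"
  shows "\<exists>W \<in> carrier_mat n n. transpose_mat W * W = 1\<^sub>m n \<and> col W 0 = v"
proof -
  define w where "w i = v $ i - (if i = 0 then 1 else 0)" for i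
  \<comment> \<open>A reflection along \<open>w\<close> is the identity minus
    \<open>2 / (w . w)\<close> times \<open>w w^T\<close>, and \<open>w . w = 2 - 2 * v $ 0\<close>
    for a unit vector \<open>v\<close>. If \<open>v $ 0 = 1\<close>, then \<open>w\<close> is zero
    and \<open>c = 0\<close> gives the identity matrix.\<close>
  define c where "c = (if v $ 0 = 1 then 0 else 1 / (1 - v $ 0))"
  define W where "W = mat n n (\<lambda>(i, j). (if i = j then 1 else 0) - c * (w i * w j))"
  have W: "W \<in> carrier_mat n n" by (simp add: W_def)
  have norm': "(\<Sum>i<n. v $ i * v $ i) = 1"
    using norm v by (simp add: scalar_prod_def atLeast0LessThan)
  have ww: "(\<Sum>i<n. w i * w i) = 2 - 2 * v $ 0"
  proof -
    have "(\<Sum>i<n. w i * w i) = (\<Sum>i<n. v $ i * v $ i + (if i = 0 then 1 - 2 * v $ 0 else 0))"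
      by (intro sum.cong refl) (auto simp: w_def algebra_simps)
    also have "\<dots> = 2 - 2 * v $ 0"
      using n by (simp add: sum.distrib norm')
    finally show ?thesis .
  qed
  have c2: "c * (c * (2 - 2 * v $ 0)) = 2 * c"
  proof -
    have "c * (2 - 2 * v $ 0) = 2 \<or> c = 0" by (simp add: c_def field_simps)
    then show ?thesis by auto
  qed
  have "(transpose_mat W * W) $$ (i, j) = 1\<^sub>m n $$ (i, j)" if ij: "i < n" "j < n" for i j
  proof -
    have "(transpose_mat W * W) $$ (i, j) =
      (\<Sum>k<n. ((if k = i then 1 else 0) - c * (w k * w i)) * ((if k = j then 1 else 0) - c * (w k * w j)))"
      using ij W by (simp add: scalar_prod_def atLeast0LessThan W_def)
    also have "\<dots> = (\<Sum>k<n. (if k = i then (if i = j then 1 else 0) else 0)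
        - (if k = i then c * (w i * w j) else 0) - (if k = j then c * (w j * w i) else 0)
        + c * (c * (w k * w k)) * (w i * w j))"
      by (intro sum.cong refl) (auto simp: algebra_simps)
    also have "\<dots> = (if i = j then 1 else 0) - 2 * c * (w i * w j)
        + c * (c * (\<Sum>k<n. w k * w k)) * (w i * w j)"
      using ij by (simp add: sum.distrib sum_subtractf sum_distrib_left sum_distrib_right)
    also have "\<dots> = 1\<^sub>m n $$ (i, j)" unfolding ww c2 using ij by simp
    finally show ?thesis .
  qed
  then have "transpose_mat W * W = 1\<^sub>m n" using W by (intro eq_matI) auto
  moreover have "col W 0 = v"
  proof (rule eq_vecI)
    fix i assume "i < dim_vec v"
    then have i: "i < n" using v by simp
    show "col W 0 $ i = v $ i"
    proof (cases "v $ 0 = 1")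
      case False
      then have "c * w 0 = - 1" by (simp add: c_def w_def field_simps)
      then have "c * (w i * w 0) = - w i" by (metis mult.left_commute mult_minus1_right)
      then show ?thesis using i n by (simp add: W_def w_def)
    next
      case True
      then have "(\<Sum>k<n. w k * w k) = 0" using ww by simp
      then have "w i = 0" using i by (subst (asm) sum_nonneg_eq_0_iff) auto
      then show ?thesis using i n by (simp add: W_def w_def c_def True)
    qed
  qed (use v W in auto)
  ultimately show ?thesis using W by blast
qed

text \<open>Induction by deflation. Conjugating with an orthogonal matrix whose first column is a
  unit eigenvector clears the first column below the diagonal; symmetry clears the first row, and
  the remaining block is again symmetric.\<close>

lemma symmetric_real_mat_diagonalization:
  fixes A :: "real mat"
  assumes "A \<in> carrier_mat n n" and "transpose_mat A = A"
  shows "\<exists>U \<in> carrier_mat n n. \<exists>d. transpose_mat U * U = 1\<^sub>m n \<and> transpose_mat U * A * U = mat_diag n d"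
  using assms
proof (induction n arbitrary: A)
  case 0
  then show ?case by (intro bexI[of _ "1\<^sub>m 0"] exI[of _ "\<lambda>_. 0"]) (auto intro!: eq_matI simp: mat_diag_def)
next
  case (Suc n)
  note A = Suc.prems(1) and sym = Suc.prems(2)
  obtain a v' where v': "v' \<in> carrier_vec (Suc n)" "v' \<noteq> 0\<^sub>v (Suc n)" "A *\<^sub>v v' = a \<cdot>\<^sub>v v'"
    using symmetric_real_eigenvector_exists[OF A sym] by auto
  define r where "r = v' \<bullet> v'"
  have r: "r > 0"
  proof -
    obtain i where "i < Suc n" "v' $ i \<noteq> 0" using v' by (metis eq_vecI carrier_vecD index_zero_vec)
    then show ?thesis unfolding r_def scalar_prod_def using v'
      by (intro sum_pos2[where i = i]) (auto simp: zero_less_mult_iff)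
  qed
  define v where "v = (1 / sqrt r) \<cdot>\<^sub>v v'"
  have v: "v \<in> carrier_vec (Suc n)" using v' by (simp add: v_def)
  have vv: "v \<bullet> v = 1"
    using v' r by (simp add: v_def r_def[symmetric])
  have Av: "A *\<^sub>v v = a \<cdot>\<^sub>v v"
    unfolding v_def mult_mat_vec[OF A v'(1)] v'(3) by (simp add: smult_smult_assoc)
  obtain W where W: "W \<in> carrier_mat (Suc n) (Suc n)" and WW: "transpose_mat W * W = 1\<^sub>m (Suc n)"
    and Wv: "col W 0 = v"
    using orthogonal_mat_with_first_col[OF v _ vv] by auto
  define B where "B = transpose_mat W * A * W"
  have B: "B \<in> carrier_mat (Suc n) (Suc n)" using W A by (simp add: B_def)
  have symB: "transpose_mat B = B"
    unfolding B_def using W A sym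
    by (simp add: transpose_mult[where nr = "Suc n" and n = "Suc n" and nc = "Suc n"]
       assoc_mult_mat[where n\<^sub>1 = "Suc n" and n\<^sub>2 = "Suc n" and n\<^sub>3 = "Suc n" and n\<^sub>4 = "Suc n"])
  have Bi0: "B $$ (i, 0) = (if i = 0 then a else 0)" if i: "i < Suc n" for i
  proof -
    have "B $$ (i, 0) = (transpose_mat W * (A * W)) $$ (i, 0)"
      unfolding B_def using W A by (subst assoc_mult_mat[where n\<^sub>1 = "Suc n"]) auto
    also have "\<dots> = col W i \<bullet> col (A * W) 0"
      using W A i by simp
    also have "col (A * W) 0 = A *\<^sub>v v" unfolding Wv[symmetric] by (rule col_mult2[OF A W]) simp
    also have "\<dots> = a \<cdot>\<^sub>v col W 0" by (simp add: Av Wv)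
    also have "col W i \<bullet> (a \<cdot>\<^sub>v col W 0) = a * (transpose_mat W * W) $$ (i, 0)"
      using W i by simp
    also have "\<dots> = (if i = 0 then a else 0)" unfolding WW using i by simp
    finally show ?thesis .
  qed
  have symB': "B $$ (i, j) = B $$ (j, i)" if "i < Suc n" "j < Suc n" for i j
    using symB that B by (metis carrier_matD index_transpose_mat(1))
  define A3 where "A3 = mat n n (\<lambda>(i, j). B $$ (Suc i, Suc j))"
  have A3: "A3 \<in> carrier_mat n n" by (simp add: A3_def)
  have "transpose_mat A3 = A3" unfolding A3_def using symB' by (intro eq_matI) auto
  from Suc.IH[OF A3 this] obtain U3 d3 where U3: "U3 \<in> carrier_mat n n"
    "transpose_mat U3 * U3 = 1\<^sub>m n" "transpose_mat U3 * A3 * U3 = mat_diag n d3" by auto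
  have Bblock: "B = four_block_mat (mat 1 1 (\<lambda>_. a)) (0\<^sub>m 1 n) (0\<^sub>m n 1) A3"
    using B Bi0 symB' by (intro eq_matI) (auto simp: A3_def)
  define X where "X = four_block_mat (1\<^sub>m 1) (0\<^sub>m 1 n) (0\<^sub>m n 1) U3"
  have X: "X \<in> carrier_mat (Suc n) (Suc n)" using U3 by (auto simp: X_def)
  have Xt: "transpose_mat X = four_block_mat (1\<^sub>m 1) (0\<^sub>m 1 n) (0\<^sub>m n 1) (transpose_mat U3)"
    unfolding X_def using U3 by (subst transpose_four_block_mat[where ?nr1.0 = 1 and ?nc1.0 = 1 and ?nr2.0 = n and ?nc2.0 = n]) auto
  have XX: "transpose_mat X * X = 1\<^sub>m (Suc n)"
    unfolding Xt unfolding X_def using U3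
    by (subst mult_four_block_mat[where ?nr1.0 = 1 and ?n1.0 = 1 and ?nr2.0 = n and ?n2.0 = n and ?nc1.0 = 1 and ?nc2.0 = n])
      (auto intro!: eq_matI)
  have XBX: "transpose_mat X * B * X = mat_diag (Suc n) (\<lambda>i. if i = 0 then a else d3 (i - 1))"
  proof -
    have "transpose_mat X * B = four_block_mat (mat 1 1 (\<lambda>_. a)) (0\<^sub>m 1 n) (0\<^sub>m n 1) (transpose_mat U3 * A3)"
      unfolding Xt Bblock using U3 A3
      by (subst mult_four_block_mat[where ?nr1.0 = 1 and ?n1.0 = 1 and ?nr2.0 = n and ?n2.0 = n and ?nc1.0 = 1 and ?nc2.0 = n])
        auto
    moreover have "\<dots> * X = four_block_mat (mat 1 1 (\<lambda>_. a)) (0\<^sub>m 1 n) (0\<^sub>m n 1) (mat_diag n d3)"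
      unfolding X_def using U3 A3
      by (subst mult_four_block_mat[where ?nr1.0 = 1 and ?n1.0 = 1 and ?nr2.0 = n and ?n2.0 = n and ?nc1.0 = 1 and ?nc2.0 = n])
        auto
    moreover have "\<dots> = mat_diag (Suc n) (\<lambda>i. if i = 0 then a else d3 (i - 1))"
      by (intro eq_matI) (auto simp: mat_diag_def)
    ultimately show ?thesis by simp
  qed
  have "transpose_mat (W * X) * (W * X) = transpose_mat X * (transpose_mat W * W) * X"
    using W X by (simp add: transpose_mult[where nr = "Suc n" and n = "Suc n" and nc = "Suc n"]
       assoc_mult_mat[where n\<^sub>1 = "Suc n" and n\<^sub>2 = "Suc n" and n\<^sub>3 = "Suc n" and n\<^sub>4 = "Suc n"])
  then have 1: "transpose_mat (W * X) * (W * X) = 1\<^sub>m (Suc n)" using XX X by (simp add: WW)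
  have "transpose_mat (W * X) * A * (W * X) = transpose_mat X * B * X"
    unfolding B_def using W X A by (simp add: transpose_mult[where nr = "Suc n" and n = "Suc n" and nc = "Suc n"]
       assoc_mult_mat[where n\<^sub>1 = "Suc n" and n\<^sub>2 = "Suc n" and n\<^sub>3 = "Suc n" and n\<^sub>4 = "Suc n"])
  with 1 XBX show ?case using W X by (intro bexI[of _ "W * X"]) auto
qed

section \<open>Eigenvalue counts read off a diagonalization\<close>

lemma order_prod_linear_factors:
  "Polynomial.order a (\<Prod>x\<leftarrow>xs. [:- x, 1:]) = length (filter ((=) a) xs)" for a :: "'a::idom"
proof (induction xs)
  case (Cons x xs)
  have "(\<Prod>x\<leftarrow>xs. [:- x, 1:]) \<noteq> 0" by (auto simp: prod_list_zero_iff)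
  moreover have "Polynomial.order a [:- x, 1:] = (if a = x then 1 else 0)"
    using order_power_n_n[of x 1] by (auto intro: order_0I)
  ultimately show ?case using Cons by (simp add: order_mult del: mult_pCons_left)
qed simp

text \<open>Orthogonality makes \<open>A\<close> similar to the diagonal matrix, so the
  characteristic polynomials agree and the multiplicity of a root is the number of its positions on
  the diagonal.\<close>

lemma eigenvalue_count_diagonalized:
  assumes A: "A \<in> carrier_mat n n" and U: "U \<in> carrier_mat n n"
    and UU: "transpose_mat U * U = 1\<^sub>m n" and D: "transpose_mat U * A * U = mat_diag n d"
  shows "eigenvalue_count P A = card {k. k < n \<and> P (d k)}"
proof -
  have UU': "U * transpose_mat U = 1\<^sub>m n"
    using mat_mult_left_right_inverse[OF _ U UU] U by simp
  have "A = (U * transpose_mat U) * A * (U * transpose_mat U)" using A by (simp add: UU')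
  also have "\<dots> = U * (transpose_mat U * A * U) * transpose_mat U"
    using U A by (simp add: assoc_mult_mat[where n\<^sub>1 = n and n\<^sub>2 = n and n\<^sub>3 = n and n\<^sub>4 = n])
  finally have "similar_mat A (mat_diag n d)"
    using A U UU UU' D by (intro similar_matI[of _ _ U "transpose_mat U" n]) auto
  then have "char_poly A = char_poly (mat_diag n d)" by (rule char_poly_similar)
  also have "\<dots> = (\<Prod>a\<leftarrow>diag_mat (mat_diag n d). [:- a, 1:])"
    by (rule char_poly_upper_triangular) (auto simp: mat_diag_def)
  also have "diag_mat (mat_diag n d) = map d [0..<n]"
    by (auto simp: diag_mat_def mat_diag_def)
  finally have cp: "char_poly A = (\<Prod>a\<leftarrow>map d [0..<n]. [:- a, 1:])" .
  have ev: "eigenvalue A a \<longleftrightarrow> a \<in> d ` {..<n}" for a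
    unfolding eigenvalue_root_char_poly[OF A] cp poly_prod_list by (auto simp: prod_list_zero_iff)
  have ord: "Polynomial.order a (char_poly A) = card {k. k < n \<and> d k = a}" for a
    unfolding cp order_prod_linear_factors
    by (subst length_filter_conv_card) (auto intro!: arg_cong[where f = card])
  have "eigenvalue_count P A = (\<Sum>a\<in>{a \<in> d ` {..<n}. P a}. card {k. k < n \<and> d k = a})"
    unfolding eigenvalue_count_def by (simp add: ev ord)
  also have "\<dots> = card (\<Union>a\<in>{a \<in> d ` {..<n}. P a}. {k. k < n \<and> d k = a})"
    by (subst card_UN_disjoint) auto
  also have "(\<Union>a\<in>{a \<in> d ` {..<n}. P a}. {k. k < n \<and> d k = a}) = {k. k < n \<and> P (d k)}" by auto
  finally show ?thesis .
qed

lemma eigenvalue_count_uminus: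
  assumes A: "A \<in> carrier_mat n n" and sym: "transpose_mat A = A"
  shows "eigenvalue_count P (- A) = eigenvalue_count (\<lambda>a. P (- a)) A"
proof -
  obtain U d where U: "U \<in> carrier_mat n n" and UU: "transpose_mat U * U = 1\<^sub>m n"
    and D: "transpose_mat U * A * U = mat_diag n d"
    using symmetric_real_mat_diagonalization[OF A sym] by auto
  have "transpose_mat U * (- A) * U = - (transpose_mat U * A * U)"
    using A U by simp
  also have "\<dots> = mat_diag n (\<lambda>k. - d k)" unfolding D by (intro eq_matI) (auto simp: mat_diag_def)
  finally show ?thesis
    using eigenvalue_count_diagonalized[OF _ U UU] eigenvalue_count_diagonalized[OF A U UU D] A
    by simp
qed

text \<open>The form in which the spectral theorem is applied: \<open>u k\<close> is the k-th
  eigenvector, \<open>c\<close> are coordinates in which the quadratic form is diagonal, and the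
  last two facts say that the \<open>u k\<close> form a basis. Plain functions are used so that
  positions can later be replaced by vertices or edges.\<close>

lemma symmetric_real_mat_inertia:
  fixes A :: "real mat"
  assumes A: "A \<in> carrier_mat n n" and sym: "transpose_mat A = A"
  obtains d u where
    "\<And>P. eigenvalue_count P A = card {k. k < n \<and> P (d k)}"
    "\<And>c. (\<Sum>i<n. \<Sum>j<n. (\<Sum>k<n. c k * u k i) * A $$ (i, j) * (\<Sum>k<n. c k * u k j)) = (\<Sum>k<n. d k * (c k)\<^sup>2)"
    "\<And>c. (\<forall>i<n. (\<Sum>k<n. c k * u k i) = 0) \<Longrightarrow> \<forall>k<n. c k = (0::real)"
    "\<And>w. \<exists>c. \<forall>i<n. w i = (\<Sum>k<n. c k * u k i)"
proof -
  obtain U d where U: "U \<in> carrier_mat n n" and UU: "transpose_mat U * U = 1\<^sub>m n"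
    and D: "transpose_mat U * A * U = mat_diag n d"
    using symmetric_real_mat_diagonalization[OF A sym] by auto
  show thesis
  proof (rule that[of d "\<lambda>k i. U $$ (i, k)"])
    show "eigenvalue_count P A = card {k. k < n \<and> P (d k)}" for P
      by (rule eigenvalue_count_diagonalized[OF A U UU D])
    have Uc: "(U *\<^sub>v vec n c) $ i = (\<Sum>k<n. c k * U $$ (i, k))" if "i < n" for c i
      using that U by (simp add: scalar_prod_def atLeast0LessThan mult.commute)
    show "(\<Sum>i<n. \<Sum>j<n. (\<Sum>k<n. c k * U $$ (i, k)) * A $$ (i, j) * (\<Sum>k<n. c k * U $$ (j, k)))
      = (\<Sum>k<n. d k * (c k)\<^sup>2)" for c
    proof -
      let ?x = "U *\<^sub>v vec n c"
      have x: "?x \<in> carrier_vec n" using U by simp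
      have "(\<Sum>i<n. \<Sum>j<n. (\<Sum>k<n. c k * U $$ (i, k)) * A $$ (i, j) * (\<Sum>k<n. c k * U $$ (j, k)))
        = (\<Sum>i<n. \<Sum>j<n. ?x $ i * A $$ (i, j) * ?x $ j)" by (simp add: Uc)
      also have "\<dots> = ?x \<bullet> (A *\<^sub>v ?x)"
        using A U by (simp add: scalar_prod_def atLeast0LessThan sum_distrib_left mult.assoc)
      also have "\<dots> = (transpose_mat U *\<^sub>v (A *\<^sub>v ?x)) \<bullet> vec n c"
        using U A x
        by (subst transpose_vec_mult_scalar[where nr = n and nc = n and A = U])
           (auto intro: comm_scalar_prod[where n = n])
      also have "transpose_mat U *\<^sub>v (A *\<^sub>v ?x) = (transpose_mat U * A * U) *\<^sub>v vec n c"
        using U A by (simp add: assoc_mult_mat_vec[where n\<^sub>1 = n and n\<^sub>2 = n and n\<^sub>3 = n])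
      also have "\<dots> \<bullet> vec n c = (\<Sum>k<n. d k * (c k)\<^sup>2)"
      proof -
        have "(mat_diag n d *\<^sub>v vec n c) $ k = d k * c k" if "k < n" for k
          using that by (simp add: mat_diag_def scalar_prod_def if_distrib[where f = "\<lambda>x. x * _"] cong: if_cong)
        then show ?thesis unfolding D
          by (simp add: scalar_prod_def atLeast0LessThan power2_eq_square mult.assoc)
      qed
      finally show ?thesis .
    qed
    show "\<forall>k<n. c k = 0" if "\<forall>i<n. (\<Sum>k<n. c k * U $$ (i, k)) = 0" for c
    proof -
      have "U *\<^sub>v vec n c = 0\<^sub>v n" using that Uc U by (intro eq_vecI) auto
      then have "transpose_mat U *\<^sub>v (U *\<^sub>v vec n c) = 0\<^sub>v n" using U by (intro eq_vecI) (auto simp: scalar_prod_def)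
      then have "vec n c = 0\<^sub>v n" using U UU
        by (simp flip: assoc_mult_mat_vec[where n\<^sub>1 = n and n\<^sub>2 = n and n\<^sub>3 = n])
      then show ?thesis by (metis index_vec index_zero_vec(1))
    qed
    show "\<exists>c. \<forall>i<n. w i = (\<Sum>k<n. c k * U $$ (i, k))" for w
    proof -
      have UU': "U * transpose_mat U = 1\<^sub>m n"
        using mat_mult_left_right_inverse[OF _ U UU] U by simp
      have "vec n w = U *\<^sub>v (transpose_mat U *\<^sub>v vec n w)"
        using U UU' by (simp flip: assoc_mult_mat_vec[where n\<^sub>1 = n and n\<^sub>2 = n and n\<^sub>3 = n])
      moreover have "transpose_mat U *\<^sub>v vec n w = vec n (\<lambda>k. (transpose_mat U *\<^sub>v vec n w) $ k)"
        using U by (intro eq_vecI) auto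
      ultimately have "vec n w = U *\<^sub>v vec n (\<lambda>k. (transpose_mat U *\<^sub>v vec n w) $ k)" by simp
      then show ?thesis using Uc by (metis index_vec)
    qed
  qed
qed

section \<open>Homogeneous linear systems, paths, cycles and cuts\<close>

text \<open>Gaussian elimination by induction on the equations: an equation with a nonzero
  coefficient at \<open>p\<close> is solved for the unknown \<open>p\<close>, which costs one
  equation and one unknown.\<close>

lemma homogeneous_system_nonzero_solution:
  fixes a :: "'j \<Rightarrow> 'i \<Rightarrow> real"
  assumes "finite J" and "finite I" and "card J < card I"
  shows "\<exists>c. (\<exists>i\<in>I. c i \<noteq> 0) \<and> (\<forall>j\<in>J. (\<Sum>i\<in>I. a j i * c i) = 0)"
  using assms
proof (induction J arbitrary: I a rule: finite_induct)
  case empty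
  then have "I \<noteq> {}" by auto
  then show ?case by (intro exI[of _ "\<lambda>_. 1"]) auto
next
  case (insert j J)
  show ?case
  proof (cases "\<forall>i\<in>I. a j i = 0")
    case True
    obtain c where "\<exists>i\<in>I. c i \<noteq> 0" "\<forall>j\<in>J. (\<Sum>i\<in>I. a j i * c i) = 0"
      using insert.IH[of I a] insert.prems insert.hyps by auto
    with True show ?thesis by (intro exI[of _ c]) auto
  next
    case False
    then obtain p where p: "p \<in> I" "a j p \<noteq> 0" by auto
    define I' where "I' = I - {p}"
    have I': "finite I'" "I = insert p I'" "p \<notin> I'" using p insert.prems by (auto simp: I'_def)
    \<comment> \<open>Row \<open>l\<close> minus the multiple of the pivot row \<open>j\<close> that
      clears column \<open>p\<close>.\<close>
    define a' where "a' l i = a l i - a l p * a j i / a j p" for l i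
    have "card J < card I'" using I' insert.prems insert.hyps by auto
    then obtain c where c: "\<exists>i\<in>I'. c i \<noteq> 0" "\<forall>l\<in>J. (\<Sum>i\<in>I'. a' l i * c i) = 0"
      using insert.IH[of I' a'] I' by blast
    define s where "s = - (\<Sum>i\<in>I'. a j i * c i) / a j p"
    define c' where "c' i = (if i = p then s else c i)" for i
    have sum': "(\<Sum>i\<in>I. a l i * c' i) = a l p * s + (\<Sum>i\<in>I'. a l i * c i)" for l
    proof -
      have "(\<Sum>i\<in>I'. a l i * c' i) = (\<Sum>i\<in>I'. a l i * c i)"
        using I' by (intro sum.cong refl) (auto simp: c'_def)
      then show ?thesis unfolding I'(2) using I' by (simp add: c'_def)
    qed
    have "(\<Sum>i\<in>I. a l i * c' i) = 0" if "l \<in> insert j J" for l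
    proof (cases "l = j")
      case True
      then show ?thesis using p unfolding sum' by (simp add: s_def)
    next
      case False
      then have "0 = (\<Sum>i\<in>I'. a' l i * c i)" using c that by auto
      also have "\<dots> = (\<Sum>i\<in>I'. a l i * c i) - (\<Sum>i\<in>I'. a l p / a j p * (a j i * c i))"
        unfolding sum_subtractf[symmetric] by (intro sum.cong refl) (simp add: a'_def field_simps p)
      also have "\<dots> = (\<Sum>i\<in>I. a l i * c' i)"
        unfolding sum' by (simp only: s_def sum_distrib_left[symmetric]) simp
      finally show ?thesis by simp
    qed
    moreover have "\<exists>i\<in>I. c' i \<noteq> 0" using c I' by (auto simp: c'_def)
    ultimately show ?thesis by blast
  qed
qed

lemma homogeneous_system_nonzero_solution2:
  fixes a :: "'j \<Rightarrow> 'i \<Rightarrow> real" and b :: "'j \<Rightarrow> 'k \<Rightarrow> real"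
  assumes "finite J" and "finite I" and "finite K" and "card J < card I + card K"
  shows "\<exists>c d. ((\<exists>i\<in>I. c i \<noteq> 0) \<or> (\<exists>k\<in>K. d k \<noteq> 0))
    \<and> (\<forall>j\<in>J. (\<Sum>i\<in>I. a j i * c i) + (\<Sum>k\<in>K. b j k * d k) = 0)"
proof -
  have "card J < card (I <+> K)" using assms by (simp add: card_Plus)
  then obtain c where c: "\<exists>i\<in>I <+> K. c i \<noteq> 0"
    "\<forall>j\<in>J. (\<Sum>i\<in>I <+> K. case_sum (a j) (b j) i * c i) = 0"
    using homogeneous_system_nonzero_solution[of J "I <+> K" "\<lambda>j. case_sum (a j) (b j)"] assms by auto
  show ?thesis
    by (rule exI[of _ "c \<circ> Inl"], rule exI[of _ "c \<circ> Inr"])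
      (use c assms in \<open>auto simp: sum.Plus\<close>)
qed

text \<open>The two families of unknowns are coordinates in two subspaces. Extending the solution by
  zero restricts it to eigenvalues of a chosen sign while the sums still run over all indices, as
  the diagonalized forms require.\<close>

lemma homogeneous_system_supported_solution2:
  fixes a :: "'j \<Rightarrow> 'i \<Rightarrow> real" and b :: "'j \<Rightarrow> 'k \<Rightarrow> real"
  assumes "finite J" and "finite I'" and "finite K'" and "I \<subseteq> I'" and "K \<subseteq> K'" and "card J < card I + card K"
  obtains c d where "\<And>i. i \<notin> I \<Longrightarrow> c i = 0" and "\<And>k. k \<notin> K \<Longrightarrow> d k = 0"
    and "(\<exists>i\<in>I. c i \<noteq> 0) \<or> (\<exists>k\<in>K. d k \<noteq> 0)"
    and "\<And>j. j \<in> J \<Longrightarrow> (\<Sum>i\<in>I'. c i * a j i) + (\<Sum>k\<in>K'. d k * b j k) = 0"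
proof -
  have fin: "finite I" "finite K" using assms finite_subset by auto
  obtain c d where cd: "((\<exists>i\<in>I. c i \<noteq> 0) \<or> (\<exists>k\<in>K. d k \<noteq> 0))
      \<and> (\<forall>j\<in>J. (\<Sum>i\<in>I. a j i * c i) + (\<Sum>k\<in>K. b j k * d k) = 0)"
    using homogeneous_system_nonzero_solution2[OF assms(1) fin assms(6), where a = a and b = b]
    by (elim exE) (rule that)
  let ?c = "\<lambda>i. if i \<in> I then c i else 0" and ?d = "\<lambda>k. if k \<in> K then d k else 0"
  have "(\<Sum>i\<in>I'. ?c i * a j i) = (\<Sum>i\<in>I. a j i * c i)" for j
    using assms by (intro sum.mono_neutral_cong_right) auto
  moreover have "(\<Sum>k\<in>K'. ?d k * b j k) = (\<Sum>k\<in>K. b j k * d k)" for j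
    using assms by (intro sum.mono_neutral_cong_right) auto
  ultimately show thesis using cd by (intro that[of ?c ?d]) auto
qed

section \<open>Walks, cycles and connectivity\<close>

abbreviation edge_rel :: "'v set set \<Rightarrow> ('v \<times> 'v) set" where
  "edge_rel T \<equiv> {(x, y). {x, y} \<in> T}"

lemma sym_edge_rel_rtrancl: "sym ((edge_rel T)\<^sup>*)"
  by (rule sym_rtrancl) (auto simp: sym_def insert_commute)

lemma cycle_arcs_conv_nth:
  "cycle_arcs c = (\<lambda>i. (c ! i, c ! (Suc i mod length c))) ` {..<length c}"
  by (auto simp: cycle_arcs_def set_zip nth_rotate1)

text \<open>On two vertices the two arcs would be opposite to each other; from length 3 on, every
  edge of a cycle is traversed in one direction only, so that arcs and edges of the cycle correspond
  one to one.\<close>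

lemma cycle_arcs_asym:
  assumes "distinct c" and "3 \<le> length c" and "(x, y) \<in> cycle_arcs c"
  shows "(y, x) \<notin> cycle_arcs c" "x \<noteq> y"
proof -
  let ?k = "length c"
  obtain i where i: "i < ?k" "x = c ! i" "y = c ! (Suc i mod ?k)"
    using assms(3) unfolding cycle_arcs_conv_nth by auto
  have lt: "Suc l mod ?k < ?k" for l using assms(2) by (intro mod_less_divisor) auto
  show "(y, x) \<notin> cycle_arcs c"
  proof
    assume "(y, x) \<in> cycle_arcs c"
    then obtain j where j: "j < ?k" "y = c ! j" "x = c ! (Suc j mod ?k)"
      unfolding cycle_arcs_conv_nth by auto
    then have ij: "i = Suc j mod ?k" "j = Suc i mod ?k"
      using i lt nth_eq_iff_index_eq[OF assms(1)] by metis+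
    have "Suc j = ?k \<and> i = 0 \<or> i = Suc j" using ij(1) j(1) by (cases "Suc j = ?k") simp_all
    moreover have "Suc i = ?k \<and> j = 0 \<or> j = Suc i" using ij(2) i(1) by (cases "Suc i = ?k") simp_all
    ultimately show False using assms(2) by (elim disjE conjE) linarith+
  qed
  show "x \<noteq> y"
  proof
    assume "x = y"
    then have *: "i = Suc i mod ?k" using i lt nth_eq_iff_index_eq[OF assms(1)] by metis
    have **: "Suc i mod ?k = (if Suc i = ?k then 0 else Suc i)" using i(1) by simp
    have "i = (if Suc i = ?k then 0 else Suc i)" using * unfolding ** .
    then show False using assms(2) by presburger
  qed
qed

text \<open>The sources of the arcs are the vertices of \<open>c\<close>, and so are the targets, in
  rotated order.\<close>

lemma sum_cycle_arcs_diff: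
  fixes w :: "'v \<Rightarrow> real"
  assumes "distinct c"
  shows "(\<Sum>(x, y)\<in>cycle_arcs c. w x - w y) = 0"
proof -
  have d: "distinct (zip c (rotate1 c))" using assms by (simp add: distinct_zipI1)
  have "(\<Sum>(x, y)\<in>cycle_arcs c. w x - w y) = (\<Sum>p\<in>cycle_arcs c. w (fst p)) - (\<Sum>p\<in>cycle_arcs c. w (snd p))"
    by (simp add: sum_subtractf case_prod_beta)
  also have "(\<Sum>p\<in>cycle_arcs c. w (fst p)) = sum_list (map w c)"
    unfolding cycle_arcs_def sum.distinct_set_conv_list[OF d]
    by (rule arg_cong[where f = sum_list], rule nth_equalityI) auto
  also have "(\<Sum>p\<in>cycle_arcs c. w (snd p)) = sum_list (map w (rotate1 c))"
    unfolding cycle_arcs_def sum.distinct_set_conv_list[OF d]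
    by (rule arg_cong[where f = sum_list], rule nth_equalityI) auto
  also have "sum_list (map w (rotate1 c)) = sum_list (map w c)" by (cases c) auto
  finally show ?thesis by simp
qed

text \<open>Loop erasure: when a walk returns to a vertex of the path built so far, the path is cut
  back to that vertex.\<close>

lemma edge_path_distinct:
  assumes "(u, v) \<in> (edge_rel T)\<^sup>*"
  shows "\<exists>p. p \<noteq> [] \<and> hd p = u \<and> last p = v \<and> distinct p \<and> (\<forall>i. Suc i < length p \<longrightarrow> {p ! i, p ! Suc i} \<in> T)"
  using assms
proof (induction rule: rtrancl_induct)
  case base
  show ?case by (intro exI[of _ "[u]"]) auto
next
  case (step y z)
  then obtain p where p: "p \<noteq> []" "hd p = u" "last p = y" "distinct p"
    "\<And>i. Suc i < length p \<Longrightarrow> {p ! i, p ! Suc i} \<in> T" by auto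
  show ?case
  proof (cases "z \<in> set p")
    case True
    then obtain i where i: "i < length p" "p ! i = z" by (auto simp: in_set_conv_nth)
    have "last (take (Suc i) p) = z" using i by (simp add: take_Suc_conv_app_nth)
    then show ?thesis using p i by (intro exI[of _ "take (Suc i) p"]) auto
  next
    case False
    have "{(p @ [z]) ! i, (p @ [z]) ! Suc i} \<in> T" if "Suc i < length (p @ [z])" for i
    proof (cases "Suc i < length p")
      case True
      then show ?thesis using p(5) by (simp add: nth_append)
    next
      case False
      then have "Suc i = length p" using that by simp
      then have "i = length p - 1" by simp
      then have "(p @ [z]) ! i = y" "(p @ [z]) ! Suc i = z"
        using p by (auto simp: nth_append last_conv_nth)
      then show ?thesis using step by simp
    qed
    then show ?thesis using p False by (intro exI[of _ "p @ [z]"]) auto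
  qed
qed

text \<open>The rest of the cycle joins the two ends of its closing edge, so every walk can avoid
  that edge by a detour.\<close>

lemma graph_connected_remove_cycle_edge:
  assumes conn: "graph_connected V T" and c: "graph_cycle V T c"
  shows "graph_connected V (T - {{last c, hd c}})" and "{last c, hd c} \<in> T"
proof -
  let ?k = "length c"
  let ?e = "{last c, hd c}"
  have c': "distinct c" "3 \<le> ?k" "cycle_edges c \<subseteq> T" using c by (auto simp: graph_cycle_def)
  have ne: "c \<noteq> []" using c' by auto
  have lh: "last c = c ! (?k - 1)" "hd c = c ! 0" using ne by (auto simp: last_conv_nth hd_conv_nth)
  have edge: "{c ! i, c ! (Suc i mod ?k)} \<in> T" if "i < ?k" for i
    using c'(3) that unfolding cycle_edges_def cycle_arcs_conv_nth by auto
  have "Suc (?k - 1) = ?k" using c'(2) by linarith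
  then show "?e \<in> T" using edge[of "?k - 1"] c'(2) lh by simp
  have step: "{c ! i, c ! Suc i} \<in> T - {?e}" if "Suc i < ?k" for i
  proof -
    \<comment> \<open>As \<open>Suc i < length c\<close>, coincidence with the closing edge would
      force \<open>i = 0\<close> and \<open>length c = 2\<close>.\<close>
    have "{c ! i, c ! Suc i} \<noteq> ?e"
    proof
      assume "{c ! i, c ! Suc i} = ?e"
      then have "(c ! i = c ! (?k - 1) \<and> c ! Suc i = c ! 0) \<or> (c ! i = c ! 0 \<and> c ! Suc i = c ! (?k - 1))"
        unfolding lh by (auto simp: doubleton_eq_iff)
      moreover have "?k - 1 < ?k" "0 < ?k" using c' by auto
      ultimately show False using c' that nth_eq_iff_index_eq[OF c'(1)] by fastforce
    qed
    then show ?thesis using edge[of i] that by simp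
  qed
  have "i < ?k \<Longrightarrow> (c ! 0, c ! i) \<in> (edge_rel (T - {?e}))\<^sup>*" for i
  proof (induction i)
    case (Suc i)
    then have "(c ! i, c ! Suc i) \<in> edge_rel (T - {?e})" using step by auto
    with Suc show ?case by (meson Suc_lessD rtrancl.rtrancl_into_rtrancl)
  qed simp
  then have path: "(hd c, last c) \<in> (edge_rel (T - {?e}))\<^sup>*" using lh c'(2) by simp
  then have path': "(last c, hd c) \<in> (edge_rel (T - {?e}))\<^sup>*"
    using sym_edge_rel_rtrancl by (metis symE)
  have "edge_rel T \<subseteq> (edge_rel (T - {?e}))\<^sup>*"
    using path path' by (auto simp: doubleton_eq_iff)
  then have "(edge_rel T)\<^sup>* \<subseteq> (edge_rel (T - {?e}))\<^sup>*" by (rule rtrancl_subset_rtrancl)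
  then show "graph_connected V (T - {?e})" using conn unfolding graph_connected_def by blast
qed

lemma disconnected_indicator:
  assumes "V \<noteq> {}" and "\<not> graph_connected V T"
  obtains s :: "'v \<Rightarrow> real" and u v where
    "u \<in> V" "v \<in> V" "s u \<noteq> s v" "\<And>x y. {x, y} \<in> T \<Longrightarrow> s x = s y"
proof -
  obtain u v where uv: "u \<in> V" "v \<in> V" "(u, v) \<notin> (edge_rel T)\<^sup>*"
    using assms by (auto simp: graph_connected_def)
  \<comment> \<open>The indicator of the component of \<open>u\<close>.\<close>
  define s :: "'v \<Rightarrow> real" where "s x = (if (u, x) \<in> (edge_rel T)\<^sup>* then 1 else 0)" for x
  have "s x = s y" if "{x, y} \<in> T" for x y
  proof -
    have "(x, y) \<in> edge_rel T" "(y, x) \<in> edge_rel T" using that by (auto simp: insert_commute)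
    then show ?thesis unfolding s_def by (meson rtrancl.rtrancl_into_rtrancl)
  qed
  then show thesis using uv by (intro that[of u v s]) (auto simp: s_def)
qed

lemma connected_constant:
  assumes "graph_connected V T" and "\<And>x y. {x, y} \<in> T \<Longrightarrow> s x = s y" and "u \<in> V" "v \<in> V"
  shows "s u = s v"
proof -
  have "(u, v) \<in> (edge_rel T)\<^sup>*" using assms by (auto simp: graph_connected_def)
  then show ?thesis by (induction rule: rtrancl_induct) (use assms(2) in auto)
qed

text \<open>Spanning trees are handled as minimal connected edge sets: minimality says directly that
  every edge is a bridge, and a cycle would contain a removable edge.\<close>

lemma connected_minimal_subset:
  assumes "finite T" and "graph_connected V T"
  obtains T' where "T' \<subseteq> T" "graph_connected V T'" "\<And>e. e \<in> T' \<Longrightarrow> \<not> graph_connected V (T' - {e})"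
proof -
  have "\<exists>T'\<subseteq>T. graph_connected V T' \<and> (\<forall>e\<in>T'. \<not> graph_connected V (T' - {e}))"
    using assms
  proof (induction T rule: finite_psubset_induct)
    case (psubset T)
    show ?case
    proof (cases "\<exists>e\<in>T. graph_connected V (T - {e})")
      case True
      then obtain e where "e \<in> T" "graph_connected V (T - {e})" by auto
      with psubset.IH[of "T - {e}"] show ?thesis by blast
    qed (use psubset.prems in auto)
  qed
  then show thesis using that by blast
qed

lemma minimal_connected_graph_tree:
  assumes "graph_connected V T" and "\<And>e. e \<in> T \<Longrightarrow> \<not> graph_connected V (T - {e})"
  shows "graph_tree V T"
  using assms graph_connected_remove_cycle_edge unfolding graph_tree_def by blast

section \<open>Gradients, cut functions and the size of spanning trees\<close>

definition grad :: "('v set \<Rightarrow> 'v \<times> 'v) \<Rightarrow> ('v \<Rightarrow> real) \<Rightarrow> 'v set \<Rightarrow> real" where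
  "grad ori w e = w (fst (ori e)) - w (snd (ori e))"

locale connected_graph =
  fixes V :: "'v set" and E :: "'v set set" and ori :: "'v set \<Rightarrow> 'v \<times> 'v"
  assumes simple: "simple_graph V E" and conn: "graph_connected V E" and orient: "orientation E ori"
begin

lemma finite_V: "finite V" using simple by (simp add: simple_graph_def)

lemma finite_E: "finite E"
  using simple finite_subset[of E "Pow V"] by (auto simp: simple_graph_def)

lemma V_nonempty: "V \<noteq> {}" using conn by (simp add: graph_connected_def)

lemma edgeD: "{x, y} \<in> E \<Longrightarrow> x \<in> V \<and> y \<in> V \<and> x \<noteq> y"
  using simple by (fastforce simp: simple_graph_def)

lemma ori_edge: "e \<in> E \<Longrightarrow> {fst (ori e), snd (ori e)} = e"
  using orient by (auto simp: orientation_def)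

lemma ori_ends: "e \<in> E \<Longrightarrow> fst (ori e) \<in> V \<and> snd (ori e) \<in> V \<and> fst (ori e) \<noteq> snd (ori e)"
  using ori_edge edgeD by metis

lemma ori_cases: "{x, y} \<in> E \<Longrightarrow> ori {x, y} = (x, y) \<or> ori {x, y} = (y, x)"
  using ori_edge[of "{x, y}"] by (metis doubleton_eq_iff prod.collapse)

lemma abs_grad: "{x, y} \<in> E \<Longrightarrow> \<bar>grad ori w {x, y}\<bar> = \<bar>w x - w y\<bar>"
  using ori_cases[of x y] by (auto simp: grad_def)

lemma grad_eq_0: "{x, y} \<in> E \<Longrightarrow> grad ori w {x, y} = 0 \<longleftrightarrow> w x = w y"
  using abs_grad[of x y w] by (metis abs_0_eq right_minus_eq abs_eq_0_iff)

lemma grad_zero_on_connected: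
  assumes "T \<subseteq> E" and "graph_connected V T" and "\<And>e. e \<in> T \<Longrightarrow> grad ori w e = 0"
    and "u \<in> V" "v \<in> V"
  shows "w u = w v"
proof (rule connected_constant[OF assms(2) _ assms(4,5)])
  show "w x = w y" if "{x, y} \<in> T" for x y
    using assms(1,3) that grad_eq_0[of x y w] by blast
qed

lemma grad_sum: "grad ori (\<lambda>v. \<Sum>i\<in>I. c i * f i v) e = (\<Sum>i\<in>I. c i * grad ori (f i) e)"
  by (simp add: grad_def sum_subtractf[symmetric] right_diff_distrib)

text \<open>The indicator of a component of \<open>T\<close> is not constant on \<open>V\<close>,
  and \<open>E\<close> connects \<open>V\<close>, so its gradient cannot vanish on all of
  \<open>E\<close>.\<close>

lemma cut_function:
  assumes "T \<subseteq> E" and "\<not> graph_connected V T"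
  obtains s where "\<And>e. e \<in> T \<Longrightarrow> grad ori s e = 0" "\<exists>e\<in>E. grad ori s e \<noteq> 0"
proof -
  obtain s :: "'v \<Rightarrow> real" and u v where s: "u \<in> V" "v \<in> V" "s u \<noteq> s v"
    "\<And>x y. {x, y} \<in> T \<Longrightarrow> s x = s y"
    by (rule disconnected_indicator[OF V_nonempty assms(2)]) (rule that)
  have "grad ori s e = 0" if "e \<in> T" for e
  proof -
    have "e \<in> E" using that assms(1) by auto
    then have "{fst (ori e), snd (ori e)} \<in> T" using that by (simp only: ori_edge)
    then show ?thesis using s(4) by (simp add: grad_def)
  qed
  moreover have "\<exists>e\<in>E. grad ori s e \<noteq> 0"
    using grad_zero_on_connected[OF order_refl conn _ s(1,2)] s(3) by metis
  ultimately show thesis using that by blast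
qed

text \<open>A cut function of \<open>T - {e}\<close> divided by its jump across \<open>e\<close>.
  Were the jump zero, the function would be constant along the connected set \<open>T\<close>, hence
  on \<open>V\<close>.\<close>

lemma bridge_function:
  assumes "T \<subseteq> E" and "graph_connected V T" and "e \<in> T" and "\<not> graph_connected V (T - {e})"
  obtains s where "grad ori s e = 1" "\<And>e'. e' \<in> T \<Longrightarrow> e' \<noteq> e \<Longrightarrow> grad ori s e' = 0"
proof -
  obtain s where s: "\<And>e'. e' \<in> T - {e} \<Longrightarrow> grad ori s e' = 0" "\<exists>e\<in>E. grad ori s e \<noteq> 0"
    using cut_function[of "T - {e}"] assms by blast
  have "grad ori s e \<noteq> 0"
  proof
    assume "grad ori s e = 0"
    then have "\<And>e'. e' \<in> T \<Longrightarrow> grad ori s e' = 0" using s by blast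
    then have "s u = s v" if "u \<in> V" "v \<in> V" for u v
      using grad_zero_on_connected[OF assms(1,2)] that by blast
    then show False using s(2) ori_ends by (auto simp: grad_def)
  qed
  then show thesis using s
    by (intro that[of "\<lambda>x. s x / grad ori s e"]) (auto simp: grad_def diff_divide_distrib[symmetric])
qed

text \<open>With fewer edges, the values of a function that is zero at a root \<open>r\<close> are
  more numerous than the equations for zero gradient along \<open>T\<close>; a nonconstant function
  would then have zero gradient on a connected edge set.\<close>

lemma card_V_le_connected:
  assumes "T \<subseteq> E" and "graph_connected V T"
  shows "card V \<le> card T + 1"
proof (rule ccontr)
  assume *: "\<not> card V \<le> card T + 1"
  obtain r where r: "r \<in> V" using V_nonempty by auto
  have fT: "finite T" using assms finite_E finite_subset by blast
  have "card T < card (V - {r})" using r finite_V * by simp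
  from homogeneous_system_nonzero_solution[OF fT _ this,
      of "\<lambda>e i. grad ori (\<lambda>v. if v = i then 1 else 0) e"] finite_V
  obtain c where c: "\<exists>i\<in>V - {r}. c i \<noteq> 0"
    "\<forall>e\<in>T. (\<Sum>i\<in>V - {r}. grad ori (\<lambda>v. if v = i then 1 else 0) e * c i) = 0" by auto
  define w where "w v = (\<Sum>i\<in>V - {r}. c i * (if v = i then 1 else 0))" for v
  have w: "w v = (if v \<in> V - {r} then c v else 0)" for v
    unfolding w_def using finite_V by (simp add: if_distrib cong: if_cong)
  have "grad ori w e = 0" if "e \<in> T" for e
    using c(2) that unfolding w_def grad_sum by (simp add: mult.commute)
  then have "w v = w r" if "v \<in> V" for v using grad_zero_on_connected[OF assms] that r by blast
  then show False using c(1) w by (metis Diff_iff insertI1)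
qed

text \<open>Every edge of \<open>T\<close> is a bridge, and the gradients of the bridge functions
  are unit vectors on \<open>T\<close>, hence independent. Functions modulo constants, normalized by
  subtracting the value at \<open>r\<close>, have only \<open>card V - 1\<close> degrees of
  freedom.\<close>

lemma card_minimal_connected:
  assumes "T \<subseteq> E" and "graph_connected V T" and "\<And>e. e \<in> T \<Longrightarrow> \<not> graph_connected V (T - {e})"
  shows "card T + 1 = card V"
proof (rule antisym)
  show "card V \<le> card T + 1" by (rule card_V_le_connected[OF assms(1,2)])
  show "card T + 1 \<le> card V"
  proof (rule ccontr)
    assume *: "\<not> card T + 1 \<le> card V"
    obtain r where r: "r \<in> V" using V_nonempty by auto
    have fT: "finite T" using assms finite_E finite_subset by blast
    have "\<exists>s. grad ori s e = 1 \<and> (\<forall>e'\<in>T. e' \<noteq> e \<longrightarrow> grad ori s e' = 0)" if "e \<in> T" for e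
      using bridge_function[OF assms(1,2) that assms(3)[OF that]] by metis
    then obtain s where s: "\<And>e. e \<in> T \<Longrightarrow> grad ori (s e) e = 1"
      "\<And>e e'. e \<in> T \<Longrightarrow> e' \<in> T \<Longrightarrow> e' \<noteq> e \<Longrightarrow> grad ori (s e) e' = 0" by metis
    have "card (V - {r}) < card T" using card_Diff1_less[OF finite_V r] * by linarith
    from homogeneous_system_nonzero_solution[OF _ fT this, of "\<lambda>v e. s e v - s e r"] finite_V
    obtain c where c: "\<exists>e\<in>T. c e \<noteq> 0" "\<forall>v\<in>V - {r}. (\<Sum>e\<in>T. (s e v - s e r) * c e) = 0" by auto
    define w where "w v = (\<Sum>e\<in>T. c e * s e v)" for v
    have "w v = w r" if "v \<in> V" for v
    proof (cases "v = r")
      case False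
      then have "(\<Sum>e\<in>T. (s e v - s e r) * c e) = 0" using c that by auto
      then show ?thesis by (simp add: w_def algebra_simps sum_subtractf)
    qed simp
    then have w0: "grad ori w e = 0" if "e \<in> E" for e using ori_ends[OF that] by (auto simp: grad_def)
    have "c e = 0" if e: "e \<in> T" for e
    proof -
      have "0 = (\<Sum>e'\<in>T. c e' * grad ori (s e') e)" using w0 e assms(1) unfolding w_def grad_sum by auto
      also have "\<dots> = (\<Sum>e'\<in>T. if e' = e then c e else 0)"
        using s e by (intro sum.cong refl) auto
      also have "\<dots> = c e" using fT e by simp
      finally show ?thesis by simp
    qed
    then show False using c by blast
  qed
qed

section \<open>Cycles as edge functions, fundamental cycles\<close>

definition cycle_fun :: "'v list \<Rightarrow> 'v set \<Rightarrow> real" where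
  "cycle_fun c e = (if ori e \<in> cycle_arcs c then 1
     else if prod.swap (ori e) \<in> cycle_arcs c then - 1 else 0)"

lemma cycle_fun_eq_0:
  assumes "e \<in> E" shows "cycle_fun c e = 0 \<longleftrightarrow> e \<notin> cycle_edges c"
proof -
  have *: "e \<in> cycle_edges c" if "ori e \<in> cycle_arcs c \<or> prod.swap (ori e) \<in> cycle_arcs c"
  proof -
    have "e = {fst (ori e), snd (ori e)}" "e = {snd (ori e), fst (ori e)}"
      using ori_edge[OF assms] by auto
    then show ?thesis using that unfolding cycle_edges_def
      by (cases "ori e") (auto simp: image_iff intro: bexI[rotated])
  qed
  moreover have "ori e \<in> cycle_arcs c \<or> prod.swap (ori e) \<in> cycle_arcs c" if ce: "e \<in> cycle_edges c"
  proof -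
    obtain x y where "e = {x, y}" "(x, y) \<in> cycle_arcs c" using ce by (auto simp: cycle_edges_def)
    then show ?thesis using ori_cases[of x y] assms by auto
  qed
  ultimately show ?thesis by (auto simp: cycle_fun_def)
qed

lemma cycle_fun_sq: "cycle_fun c e \<noteq> 0 \<Longrightarrow> cycle_fun c e * cycle_fun c e = 1"
  by (simp add: cycle_fun_def split: if_splits)

text \<open>Reversing the orientation of an edge flips the signs of both \<open>grad\<close> and
  \<open>cycle_fun\<close>. Every edge may thus be read in the direction of traversal, and the sum
  telescopes around the cycle.\<close>

lemma cycle_fun_orthogonal_grad:
  assumes c: "graph_cycle V E c"
  shows "(\<Sum>e\<in>E. grad ori w e * cycle_fun c e) = 0"
proof -
  have c': "distinct c" "3 \<le> length c" "cycle_edges c \<subseteq> E" using c by (auto simp: graph_cycle_def)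
  have "(\<Sum>e\<in>E. grad ori w e * cycle_fun c e) = (\<Sum>e\<in>cycle_edges c. grad ori w e * cycle_fun c e)"
    using c'(3) finite_E cycle_fun_eq_0 by (intro sum.mono_neutral_right) auto
  also have "\<dots> = (\<Sum>(x, y)\<in>cycle_arcs c. grad ori w {x, y} * cycle_fun c {x, y})"
    unfolding cycle_edges_def
  proof (subst sum.reindex)
    show "inj_on (\<lambda>(u, v). {u, v}) (cycle_arcs c)"
      using cycle_arcs_asym[OF c'(1,2)] by (auto simp: inj_on_def doubleton_eq_iff)
  qed (simp add: case_prod_beta comp_def)
  also have "\<dots> = (\<Sum>(x, y)\<in>cycle_arcs c. w x - w y)"
  proof (intro sum.cong refl, safe)
    fix x y assume xy: "(x, y) \<in> cycle_arcs c"
    then have "{x, y} \<in> E" using c'(3) by (auto simp: cycle_edges_def)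
    then show "grad ori w {x, y} * cycle_fun c {x, y} = w x - w y"
      using ori_cases[of x y] xy cycle_arcs_asym[OF c'(1,2) xy] by (auto simp: grad_def cycle_fun_def)
  qed
  also have "\<dots> = 0" by (rule sum_cycle_arcs_diff[OF c'(1)])
  finally show ?thesis .
qed

text \<open>A path in \<open>T\<close> without repetitions between the ends of \<open>e\<close>,
  closed by \<open>e\<close>. It has at least three vertices, since a path with two would make
  \<open>e\<close> an edge of \<open>T\<close>.\<close>

lemma fundamental_cycle:
  assumes T: "T \<subseteq> E" "graph_connected V T" and e: "e \<in> E" "e \<notin> T"
  obtains c where "graph_cycle V E c" "cycle_edges c \<subseteq> insert e T" "e \<in> cycle_edges c"
proof -
  obtain u v where uv: "e = {u, v}" using ori_edge[OF e(1)] by metis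
  have uvV: "u \<in> V" "v \<in> V" "u \<noteq> v" using edgeD e uv by auto
  then have "(u, v) \<in> (edge_rel T)\<^sup>*" using T by (auto simp: graph_connected_def)
  from edge_path_distinct[OF this] obtain p where p: "p \<noteq> []" "hd p = u" "last p = v" "distinct p"
    "\<And>i. Suc i < length p \<Longrightarrow> {p ! i, p ! Suc i} \<in> T" by auto
  let ?k = "length p"
  have hl: "p ! 0 = u" "p ! (?k - 1) = v" using p by (auto simp: hd_conv_nth last_conv_nth)
  have "?k \<noteq> 1" using hl uvV by auto
  moreover have "?k \<noteq> 2"
  proof
    assume "?k = 2"
    then show False using p(5)[of 0] hl uv e by simp
  qed
  moreover have "?k \<noteq> 0" using p by simp
  ultimately have k: "3 \<le> ?k" by linarith
  have edges: "cycle_edges p \<subseteq> insert e T"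
  proof -
    have "{p ! i, p ! (Suc i mod ?k)} \<in> insert e T" if "i < ?k" for i
    proof (cases "Suc i < ?k")
      case False
      then have "i = ?k - 1" "Suc i mod ?k = 0" using that by (auto simp: mod_Suc)
      then show ?thesis using hl uv by (simp add: insert_commute)
    qed (use p(5) in simp)
    then show ?thesis by (auto simp: cycle_edges_def cycle_arcs_conv_nth)
  qed
  have "e \<in> cycle_edges p"
  proof -
    have "(p ! (?k - 1), p ! (Suc (?k - 1) mod ?k)) \<in> cycle_arcs p"
      unfolding cycle_arcs_conv_nth using k by (intro imageI) simp
    moreover have "Suc (?k - 1) = ?k" using k by linarith
    ultimately have "(v, u) \<in> cycle_arcs p" using hl by simp
    then show ?thesis unfolding cycle_edges_def uv by (force simp: insert_commute)
  qed
  moreover have "set p \<subseteq> V"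
  proof
    fix x assume "x \<in> set p"
    then obtain i where i: "i < ?k" "x = p ! i" by (auto simp: in_set_conv_nth)
    show "x \<in> V"
    proof (cases "i = ?k - 1")
      case False
      then have "{p ! i, p ! Suc i} \<in> E" using p(5)[of i] i T by auto
      then show ?thesis using edgeD i by blast
    qed (use i hl uvV in simp)
  qed
  ultimately show thesis using that[of p] p(4) k edges e T by (auto simp: graph_cycle_def)
qed

text \<open>The point is that \<open>K\<close> does not depend on \<open>w\<close>, so that it can
  enter the choice of edge weights. Its recursion \<open>2 * K + 2\<close> comes from
  \<open>(a + b)^2 \<le> 2 a^2 + 2 b^2\<close>.\<close>

lemma grad_path_bound:
  assumes "T \<subseteq> E" and "(u, v) \<in> (edge_rel T)\<^sup>*"
  shows "\<exists>K\<ge>0. \<forall>w. (w u - w v)\<^sup>2 \<le> K * (\<Sum>e\<in>T. (grad ori w e)\<^sup>2)"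
  using assms(2)
proof (induction rule: rtrancl_induct)
  case base
  show ?case by (intro exI[of _ 0]) auto
next
  case (step y z)
  then obtain K where K: "K \<ge> 0" "\<And>w. (w u - w y)\<^sup>2 \<le> K * (\<Sum>e\<in>T. (grad ori w e)\<^sup>2)" by auto
  have yz: "{y, z} \<in> T" "{y, z} \<in> E" using step assms(1) by auto
  have fT: "finite T" using assms finite_E finite_subset by blast
  have "(w u - w z)\<^sup>2 \<le> (2 * K + 2) * (\<Sum>e\<in>T. (grad ori w e)\<^sup>2)" for w
  proof -
    have "0 \<le> ((w u - w y) - (w y - w z))\<^sup>2" by simp
    then have "(w u - w z)\<^sup>2 \<le> 2 * (w u - w y)\<^sup>2 + 2 * (w y - w z)\<^sup>2"
      by (simp add: power2_eq_square algebra_simps)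
    moreover have "(w y - w z)\<^sup>2 = (grad ori w {y, z})\<^sup>2"
      using abs_grad[OF yz(2), of w] by (metis power2_abs)
    moreover have "\<dots> \<le> (\<Sum>e\<in>T. (grad ori w e)\<^sup>2)"
      using yz(1) fT by (intro member_le_sum) auto
    ultimately show ?thesis using K(2)[of w] by (simp add: algebra_simps)
  qed
  then show ?case using K(1) by (intro exI[of _ "2 * K + 2"]) auto
qed

end

section \<open>Quadratic forms of the Laplacian and of the cycle intersection matrix\<close>

lemma sum_enumerates:
  assumes "enumerates xs A"
  shows "(\<Sum>i<length xs. f (xs ! i)) = (\<Sum>x\<in>A. f x)"
  using assms sum.reindex_bij_betw[OF bij_betw_nth[of xs "{..<length xs}" A]]
  by (auto simp: enumerates_def)

lemma enumerates_length: "enumerates xs A \<Longrightarrow> length xs = card A"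
  by (auto simp: enumerates_def distinct_card)

definition index_of :: "'a list \<Rightarrow> 'a \<Rightarrow> nat" where
  "index_of xs x = (SOME i. i < length xs \<and> xs ! i = x)"

lemma index_of_nth: "distinct xs \<Longrightarrow> i < length xs \<Longrightarrow> index_of xs (xs ! i) = i"
  unfolding index_of_def by (rule some_equality) (auto simp: nth_eq_iff_index_eq)

lemma cycle_intersection_matrix_carrier:
  "cycle_intersection_matrix es \<gamma> ys \<in> carrier_mat (length ys) (length ys)"
  by (intro carrier_matI) (simp_all add: cycle_intersection_matrix_def Let_def)

lemma cycle_intersection_matrix_index:
  assumes "set ys \<subseteq> carrier_vec (length es)" and ij: "i < length ys" "j < length ys"
  shows "cycle_intersection_matrix es \<gamma> ys $$ (i, j)
    = - (\<Sum>l<length es. ys ! i $ l * inverse (\<gamma> (es ! l)) * ys ! j $ l)"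
proof -
  let ?m = "length es" and ?C = "length ys"
  have dim: "dim_vec (ys ! k) = ?m" if "k < ?C" for k using assms(1) that nth_mem by fastforce
  let ?Y = "mat_of_cols ?m ys"
  have "(transpose_mat ?Y * mat_diag ?m (\<lambda>k. inverse (\<gamma> (es ! k))) * ?Y) $$ (i, j)
    = (\<Sum>l<?m. ys ! i $ l * inverse (\<gamma> (es ! l)) * ys ! j $ l)"
    using ij by (subst mat_diag_mult_right[where nr = ?C])
      (auto simp: scalar_prod_def atLeast0LessThan mat_of_cols_index)
  then show ?thesis using ij by (simp add: cycle_intersection_matrix_def Let_def mat_diag_def)
qed

lemma cycle_intersection_matrix_symmetric:
  assumes "set ys \<subseteq> carrier_vec (length es)"
  shows "transpose_mat (cycle_intersection_matrix es \<gamma> ys) = cycle_intersection_matrix es \<gamma> ys"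
    (is "transpose_mat ?Z = ?Z")
proof (rule eq_matI)
  have Z: "?Z \<in> carrier_mat (length ys) (length ys)" by (rule cycle_intersection_matrix_carrier)
  show "transpose_mat ?Z $$ (i, j) = ?Z $$ (i, j)" if "i < dim_row ?Z" "j < dim_col ?Z" for i j
    using that Z by (simp add: cycle_intersection_matrix_index[OF assms] mult_ac)
qed (use cycle_intersection_matrix_carrier[of es \<gamma> ys] in auto)

lemma cycle_intersection_matrix_uminus:
  assumes "set ys \<subseteq> carrier_vec (length es)"
  shows "cycle_intersection_matrix es (\<lambda>e. - \<gamma> e) ys = - cycle_intersection_matrix es \<gamma> ys"
proof (rule eq_matI)
  let ?Z = "cycle_intersection_matrix es \<gamma> ys"
  have Z: "?Z \<in> carrier_mat (length ys) (length ys)" by (rule cycle_intersection_matrix_carrier)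
  show "cycle_intersection_matrix es (\<lambda>e. - \<gamma> e) ys $$ (i, j) = (- ?Z) $$ (i, j)"
    if "i < dim_row (- ?Z)" "j < dim_col (- ?Z)" for i j
    using that Z by (simp add: cycle_intersection_matrix_index[OF assms] sum_negf)
qed (simp_all add: carrier_matD[OF cycle_intersection_matrix_carrier])

context connected_graph
begin

text \<open>A basis of the orthogonal complement of the gradients, which is the cycle space:
  membership, independence and spanning, for an indexed family of functions on edges.\<close>

definition cycle_fun_basis :: "nat \<Rightarrow> (nat \<Rightarrow> 'v set \<Rightarrow> real) \<Rightarrow> bool" where
  "cycle_fun_basis C y \<longleftrightarrow>
     (\<forall>k<C. \<forall>w. (\<Sum>e\<in>E. grad ori w e * y k e) = 0)
   \<and> (\<forall>c. (\<forall>e\<in>E. (\<Sum>k<C. c k * y k e) = 0) \<longrightarrow> (\<forall>k<C. c k = 0))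
   \<and> (\<forall>x. (\<forall>w. (\<Sum>e\<in>E. grad ori w e * x e) = 0) \<longrightarrow> (\<exists>c. \<forall>e\<in>E. x e = (\<Sum>k<C. c k * y k e)))"

lemma cycle_fun_basisD:
  assumes "cycle_fun_basis C y"
  shows "k < C \<Longrightarrow> (\<Sum>e\<in>E. grad ori w e * y k e) = 0"
    and "(\<And>e. e \<in> E \<Longrightarrow> (\<Sum>k<C. c k * y k e) = 0) \<Longrightarrow> k < C \<Longrightarrow> c k = 0"
    and "(\<And>w. (\<Sum>e\<in>E. grad ori w e * x e) = 0) \<Longrightarrow> \<exists>c. \<forall>e\<in>E. x e = (\<Sum>k<C. c k * y k e)"
  using assms unfolding cycle_fun_basis_def by simp_all

text \<open>Every edge gives two ordered pairs of adjacent vertices, \<open>ori e\<close> and its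
  swap, and these are different for all edges.\<close>

lemma sum_incident_edges:
  "(\<Sum>v\<in>V. \<Sum>u\<in>V. if {v, u} \<in> E then h v u else 0)
    = (\<Sum>e\<in>E. h (fst (ori e)) (snd (ori e)) + h (snd (ori e)) (fst (ori e)))" for h :: "'v \<Rightarrow> 'v \<Rightarrow> real"
proof -
  let ?A = "{(v, u). {v, u} \<in> E}"
  have A: "?A = ori ` E \<union> (prod.swap \<circ> ori) ` E"
  proof (intro equalityI subsetI)
    fix p assume "p \<in> ?A"
    then obtain x y where xy: "p = (x, y)" "{x, y} \<in> E" by auto
    then show "p \<in> ori ` E \<union> (prod.swap \<circ> ori) ` E"
      using ori_cases[OF xy(2)] by (force simp: image_iff)
  next
    fix p assume "p \<in> ori ` E \<union> (prod.swap \<circ> ori) ` E"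
    then obtain e where e: "e \<in> E" "p = ori e \<or> p = prod.swap (ori e)" by auto
    have "{fst (ori e), snd (ori e)} \<in> E" "{snd (ori e), fst (ori e)} \<in> E"
      using ori_edge[OF e(1)] e(1) by (simp_all add: insert_commute)
    then show "p \<in> ?A" using e(2) by (auto simp: case_prod_beta)
  qed
  have inj: "inj_on ori E" by (rule inj_onI) (metis ori_edge)
  then have inj': "inj_on (prod.swap \<circ> ori) E" by (rule comp_inj_on[OF _ inj_swap])
  have disj: "ori ` E \<inter> (prod.swap \<circ> ori) ` E = {}"
  proof -
    have "ori e \<noteq> prod.swap (ori e')" if "e \<in> E" "e' \<in> E" for e e'
    proof
      assume *: "ori e = prod.swap (ori e')"
      then have "fst (ori e) = snd (ori e')" "snd (ori e) = fst (ori e')" by auto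
      then have "e = e'" using ori_edge[OF that(1)] ori_edge[OF that(2)] by (metis insert_commute)
      then show False using * ori_ends[OF that(1)] by (metis fst_swap)
    qed
    then show ?thesis by (fastforce dest: sym)
  qed
  have "(\<Sum>v\<in>V. \<Sum>u\<in>V. if {v, u} \<in> E then h v u else 0)
      = (\<Sum>p\<in>V \<times> V. if p \<in> ?A then h (fst p) (snd p) else 0)"
    by (simp add: sum.cartesian_product case_prod_beta)
  also have "\<dots> = (\<Sum>p\<in>?A. h (fst p) (snd p))"
    using finite_V edgeD by (intro sum.mono_neutral_cong_right) auto
  also have "\<dots> = (\<Sum>p\<in>ori ` E. h (fst p) (snd p)) + (\<Sum>p\<in>(prod.swap \<circ> ori) ` E. h (fst p) (snd p))"
    unfolding A using finite_E disj by (intro sum.union_disjoint) auto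
  finally show ?thesis by (simp add: sum.reindex[OF inj] sum.reindex[OF inj', unfolded comp_def] comp_def sum.distrib)
qed

text \<open>The diagonal entry is spread over the edges at its vertex; the two ordered pairs of an
  edge then add up to minus a complete square.\<close>

lemma laplacian_quadratic_form:
  assumes vs: "enumerates vs V"
  shows "(\<Sum>i<length vs. \<Sum>j<length vs. w (vs ! i) * laplacian vs E \<delta> $$ (i, j) * w (vs ! j))
    = - (\<Sum>e\<in>E. \<delta> e * (grad ori w e)\<^sup>2)"
proof -
  \<comment> \<open>The Laplacian on vertices instead of positions. Adding the diagonal and
    adjacency parts is harmless, because there are no loops and the second summand is zero for
    \<open>v = u\<close>.\<close>
  define G where "G v u = (if v = u then - (\<Sum>x | {v, x} \<in> E. \<delta> {v, x}) else 0)
    + (if {v, u} \<in> E then \<delta> {v, u} else 0)" for v u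
  have d: "distinct vs" using vs by (simp add: enumerates_def)
  have "(\<Sum>i<length vs. \<Sum>j<length vs. w (vs ! i) * laplacian vs E \<delta> $$ (i, j) * w (vs ! j))
    = (\<Sum>i<length vs. \<Sum>j<length vs. w (vs ! i) * G (vs ! i) (vs ! j) * w (vs ! j))"
  proof (intro sum.cong refl)
    fix i j assume "i \<in> {..<length vs}" "j \<in> {..<length vs}"
    then show "w (vs ! i) * laplacian vs E \<delta> $$ (i, j) * w (vs ! j) = w (vs ! i) * G (vs ! i) (vs ! j) * w (vs ! j)"
      using d edgeD[of "vs ! i" "vs ! j"]
      by (auto simp: laplacian_def G_def nth_eq_iff_index_eq)
  qed
  also have "\<dots> = (\<Sum>v\<in>V. \<Sum>u\<in>V. w v * G v u * w u)"
    unfolding sum_enumerates[OF vs, of "\<lambda>u. w v * G v u * w u" for v]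
    by (rule sum_enumerates[OF vs])
  also have "\<dots> = (\<Sum>v\<in>V. \<Sum>u\<in>V. if {v, u} \<in> E then \<delta> {v, u} * (w v * w u - (w v)\<^sup>2) else 0)"
  proof (rule sum.cong[OF refl])
    fix v assume v: "v \<in> V"
    have S: "(\<Sum>x | {v, x} \<in> E. \<delta> {v, x}) = (\<Sum>u\<in>V. if {v, u} \<in> E then \<delta> {v, u} else 0)"
      using finite_V edgeD by (intro sum.mono_neutral_cong_left) auto
    have "(\<Sum>u\<in>V. w v * G v u * w u)
      = (\<Sum>u\<in>V. (if v = u then - (w v)\<^sup>2 * (\<Sum>x | {v, x} \<in> E. \<delta> {v, x}) else 0)
          + (if {v, u} \<in> E then \<delta> {v, u} * (w v * w u) else 0))"
      by (intro sum.cong refl) (auto simp: G_def power2_eq_square algebra_simps)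
    also have "\<dots> = - (w v)\<^sup>2 * (\<Sum>x | {v, x} \<in> E. \<delta> {v, x})
        + (\<Sum>u\<in>V. if {v, u} \<in> E then \<delta> {v, u} * (w v * w u) else 0)"
      using v finite_V by (simp add: sum.distrib)
    also have "\<dots> = (\<Sum>u\<in>V. if {v, u} \<in> E then \<delta> {v, u} * (w v * w u - (w v)\<^sup>2) else 0)"
      unfolding S sum_distrib_left sum.distrib[symmetric]
      by (intro sum.cong refl) (auto simp: algebra_simps)
    finally show "(\<Sum>u\<in>V. w v * G v u * w u)
      = (\<Sum>u\<in>V. if {v, u} \<in> E then \<delta> {v, u} * (w v * w u - (w v)\<^sup>2) else 0)" .
  qed
  also note sum_incident_edges[of "\<lambda>v u. \<delta> {v, u} * (w v * w u - (w v)\<^sup>2)"]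
  also have "(\<Sum>e\<in>E. \<delta> {fst (ori e), snd (ori e)} * (w (fst (ori e)) * w (snd (ori e)) - (w (fst (ori e)))\<^sup>2)
      + \<delta> {snd (ori e), fst (ori e)} * (w (snd (ori e)) * w (fst (ori e)) - (w (snd (ori e)))\<^sup>2))
    = (\<Sum>e\<in>E. - (\<delta> e * (grad ori w e)\<^sup>2))"
  proof (intro sum.cong refl)
    fix e assume "e \<in> E"
    then have "{fst (ori e), snd (ori e)} = e" "{snd (ori e), fst (ori e)} = e"
      using ori_edge by (auto simp: insert_commute)
    then show "\<delta> {fst (ori e), snd (ori e)} * (w (fst (ori e)) * w (snd (ori e)) - (w (fst (ori e)))\<^sup>2)
      + \<delta> {snd (ori e), fst (ori e)} * (w (snd (ori e)) * w (fst (ori e)) - (w (snd (ori e)))\<^sup>2)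
      = - (\<delta> e * (grad ori w e)\<^sup>2)"
      by (simp only: grad_def power2_eq_square) (simp add: algebra_simps)
  qed
  finally show ?thesis by (simp add: sum_negf)
qed

text \<open>The eigenbasis is moved from positions to vertices and the form is written with
  gradients. The \<open>d k\<close> are the eigenvalues of the Laplacian itself, hence the minus
  sign.\<close>

lemma laplacian_inertia:
  assumes vs: "enumerates vs V"
  obtains d and u :: "nat \<Rightarrow> 'v \<Rightarrow> real" where
    "\<And>P. eigenvalue_count P (laplacian vs E \<delta>) = card {k. k < length vs \<and> P (d k)}"
    "\<And>c. (\<Sum>e\<in>E. \<delta> e * (grad ori (\<lambda>v. \<Sum>k<length vs. c k * u k v) e)\<^sup>2) = - (\<Sum>k<length vs. d k * (c k)\<^sup>2)"
    "\<And>c. (\<forall>v\<in>V. (\<Sum>k<length vs. c k * u k v) = 0) \<Longrightarrow> \<forall>k<length vs. c k = 0"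
    "\<And>w. \<exists>c. \<forall>v\<in>V. w v = (\<Sum>k<length vs. c k * u k v)"
proof -
  let ?n = "length vs" and ?L = "laplacian vs E \<delta>"
  have d: "distinct vs" and s: "set vs = V" using vs by (auto simp: enumerates_def)
  have L: "?L \<in> carrier_mat ?n ?n" by (simp add: laplacian_def)
  have sym: "transpose_mat ?L = ?L" by (rule eq_matI) (auto simp: laplacian_def insert_commute)
  obtain d u where du: "\<And>P. eigenvalue_count P ?L = card {k. k < ?n \<and> P (d k)}"
    "\<And>c. (\<Sum>i<?n. \<Sum>j<?n. (\<Sum>k<?n. c k * u k i) * ?L $$ (i, j) * (\<Sum>k<?n. c k * u k j)) = (\<Sum>k<?n. d k * (c k)\<^sup>2)"
    "\<And>c. (\<forall>i<?n. (\<Sum>k<?n. c k * u k i) = 0) \<Longrightarrow> \<forall>k<?n. c k = 0"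
    "\<And>w. \<exists>c. \<forall>i<?n. w i = (\<Sum>k<?n. c k * u k i)"
    by (rule symmetric_real_mat_inertia[OF L sym]) (rule that)
  define u' where "u' k v = u k (index_of vs v)" for k v
  have u': "u' k (vs ! i) = u k i" if "i < ?n" for k i
    using that d by (simp add: u'_def index_of_nth)
  have V: "(\<forall>v\<in>V. Q v) \<longleftrightarrow> (\<forall>i<?n. Q (vs ! i))" for Q
    unfolding s[symmetric] all_set_conv_all_nth ..
  show thesis
  proof (rule that[of d u'])
    show "(\<Sum>e\<in>E. \<delta> e * (grad ori (\<lambda>v. \<Sum>k<?n. c k * u' k v) e)\<^sup>2) = - (\<Sum>k<?n. d k * (c k)\<^sup>2)" for c
      unfolding du(2)[symmetric]
      using laplacian_quadratic_form[OF vs, of "\<lambda>v. \<Sum>k<?n. c k * u' k v" \<delta>] by (simp add: u')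
    show "\<forall>k<?n. c k = 0" if "\<forall>v\<in>V. (\<Sum>k<?n. c k * u' k v) = 0" for c
    proof -
      have "\<forall>i<?n. (\<Sum>k<?n. c k * u k i) = 0" using that unfolding V by (simp add: u')
      then show ?thesis by (rule du(3))
    qed
    show "\<exists>c. \<forall>v\<in>V. w v = (\<Sum>k<?n. c k * u' k v)" for w
      using du(4)[of "\<lambda>i. w (vs ! i)"] unfolding V by (simp add: u')
  qed (rule du(1))
qed

text \<open>From here on, stability is a sign condition on the form at gradients, and claims (3) and
  (4) no longer mention eigenvalues.\<close>

lemma laplacian_stable_iff:
  assumes vs: "enumerates vs V"
  shows "laplacian_stable vs E \<delta> \<longleftrightarrow> (\<forall>w. 0 \<le> (\<Sum>e\<in>E. \<delta> e * (grad ori w e)\<^sup>2))"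
proof -
  let ?n = "length vs"
  obtain d and u :: "nat \<Rightarrow> 'v \<Rightarrow> real" where du:
    "\<And>P. eigenvalue_count P (laplacian vs E \<delta>) = card {k. k < ?n \<and> P (d k)}"
    "\<And>c. (\<Sum>e\<in>E. \<delta> e * (grad ori (\<lambda>v. \<Sum>k<?n. c k * u k v) e)\<^sup>2) = - (\<Sum>k<?n. d k * (c k)\<^sup>2)"
    "\<And>c. (\<forall>v\<in>V. (\<Sum>k<?n. c k * u k v) = 0) \<Longrightarrow> \<forall>k<?n. c k = 0"
    "\<And>w. \<exists>c. \<forall>v\<in>V. w v = (\<Sum>k<?n. c k * u k v)"
    by (rule laplacian_inertia[OF vs, of \<delta>]) (rule that)
  have "laplacian_stable vs E \<delta> \<longleftrightarrow> (\<forall>k<?n. d k \<le> 0)"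
    unfolding laplacian_stable_def n_pos_def du(1) by (auto simp: not_less) (meson not_le)
  also have "\<dots> \<longleftrightarrow> (\<forall>w. 0 \<le> (\<Sum>e\<in>E. \<delta> e * (grad ori w e)\<^sup>2))"
  proof (intro iffI allI impI)
    fix w :: "'v \<Rightarrow> real"
    assume neg: "\<forall>k<?n. d k \<le> 0"
    obtain c where c: "\<forall>v\<in>V. w v = (\<Sum>k<?n. c k * u k v)" using du(4)[of w] by auto
    have "(\<Sum>e\<in>E. \<delta> e * (grad ori w e)\<^sup>2) = (\<Sum>e\<in>E. \<delta> e * (grad ori (\<lambda>v. \<Sum>k<?n. c k * u k v) e)\<^sup>2)"
      using c ori_ends by (intro sum.cong refl) (auto simp: grad_def)
    also have "\<dots> \<ge> 0" unfolding du(2)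
      using neg by (auto intro!: sum_nonpos simp: mult_nonpos_nonneg)
    finally show "0 \<le> (\<Sum>e\<in>E. \<delta> e * (grad ori w e)\<^sup>2)" .
  next
    fix k
    assume *: "\<forall>w. 0 \<le> (\<Sum>e\<in>E. \<delta> e * (grad ori w e)\<^sup>2)" and k: "k < ?n"
    \<comment> \<open>The coordinates of the k-th eigenvector isolate \<open>d k\<close>.\<close>
    have "(\<Sum>l<?n. d l * (if l = k then 1 else 0 :: real)\<^sup>2) = (\<Sum>l<?n. if l = k then d k else 0)"
      by (intro sum.cong refl) auto
    also have "\<dots> = d k" using k by simp
    finally have dk: "(\<Sum>l<?n. d l * (if l = k then 1 else 0 :: real)\<^sup>2) = d k" .
    have "0 \<le> (\<Sum>e\<in>E. \<delta> e * (grad ori (\<lambda>v. \<Sum>l<?n. (if l = k then 1 else 0) * u l v) e)\<^sup>2)"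
      by (rule *[rule_format])
    then show "d k \<le> 0" unfolding du(2) dk by simp
  qed
  finally show ?thesis .
qed

text \<open>As \<open>\<gamma> (X / \<gamma>)^2 = X^2 / \<gamma>\<close> for a nonzero weight, the
  form with inverse weights at \<open>X\<close> is the edge form at
  \<open>X / \<gamma>\<close>.\<close>

lemma cycle_intersection_inertia:
  assumes es: "enumerates es E" and ys: "set ys \<subseteq> carrier_vec (length es)"
    and basis: "cycle_fun_basis (length ys) (\<lambda>k e. ys ! k $ index_of es e)"
  obtains f and x :: "nat \<Rightarrow> 'v set \<Rightarrow> real" where
    "\<And>P. eigenvalue_count P (cycle_intersection_matrix es \<gamma> ys) = card {k. k < length ys \<and> P (f k)}"
    "\<And>c. (\<Sum>e\<in>E. inverse (\<gamma> e) * (\<Sum>k<length ys. c k * x k e)\<^sup>2) = - (\<Sum>k<length ys. f k * (c k)\<^sup>2)"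
    "\<And>c. (\<forall>e\<in>E. (\<Sum>k<length ys. c k * x k e) = 0) \<Longrightarrow> \<forall>k<length ys. c k = 0"
    "\<And>k w. (\<Sum>e\<in>E. grad ori w e * x k e) = 0"
proof -
  let ?C = "length ys" and ?m = "length es" and ?Z = "cycle_intersection_matrix es \<gamma> ys"
  define y where "y k e = ys ! k $ index_of es e" for k e
  have ynth: "y k (es ! l) = ys ! k $ l" if "l < ?m" for k l
    using that es by (simp add: y_def index_of_nth enumerates_def)
  have Z: "?Z \<in> carrier_mat ?C ?C" by (rule cycle_intersection_matrix_carrier)
  have Zij: "?Z $$ (i, j) = - (\<Sum>e\<in>E. inverse (\<gamma> e) * y i e * y j e)" if ij: "i < ?C" "j < ?C" for i j
  proof -
    have "(\<Sum>l<?m. ys ! i $ l * inverse (\<gamma> (es ! l)) * ys ! j $ l)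
      = (\<Sum>l<?m. inverse (\<gamma> (es ! l)) * y i (es ! l) * y j (es ! l))"
      by (intro sum.cong refl) (simp add: ynth mult_ac)
    also have "\<dots> = (\<Sum>e\<in>E. inverse (\<gamma> e) * y i e * y j e)"
      by (rule sum_enumerates[OF es])
    finally show ?thesis using ij by (simp add: cycle_intersection_matrix_index[OF ys])
  qed
  have sym: "transpose_mat ?Z = ?Z" by (rule cycle_intersection_matrix_symmetric[OF ys])
  obtain f z where fz: "\<And>P. eigenvalue_count P ?Z = card {k. k < ?C \<and> P (f k)}"
    "\<And>c. (\<Sum>i<?C. \<Sum>j<?C. (\<Sum>k<?C. c k * z k i) * ?Z $$ (i, j) * (\<Sum>k<?C. c k * z k j)) = (\<Sum>k<?C. f k * (c k)\<^sup>2)"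
    "\<And>c. (\<forall>i<?C. (\<Sum>k<?C. c k * z k i) = 0) \<Longrightarrow> \<forall>k<?C. c k = 0"
    "\<And>w. \<exists>c. \<forall>i<?C. w i = (\<Sum>k<?C. c k * z k i)"
    by (rule symmetric_real_mat_inertia[OF Z sym]) (rule that)
  note bas = cycle_fun_basisD[OF basis, folded y_def]
  \<comment> \<open>The element of the cycle space whose coordinates in the basis \<open>ys\<close>
    are the k-th eigenvector of the matrix.\<close>
  define x where "x k e = (\<Sum>i<?C. z k i * y i e)" for k e
  have x: "(\<Sum>k<?C. c k * x k e) = (\<Sum>i<?C. (\<Sum>k<?C. c k * z k i) * y i e)" for c e
    unfolding x_def sum_distrib_left sum_distrib_right by (subst sum.swap) (simp add: mult_ac)
  show thesis
  proof (rule that[of f x])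
    show "(\<Sum>e\<in>E. inverse (\<gamma> e) * (\<Sum>k<?C. c k * x k e)\<^sup>2) = - (\<Sum>k<?C. f k * (c k)\<^sup>2)" for c
    proof -
      define g where "g i = (\<Sum>k<?C. c k * z k i)" for i
      have "(\<Sum>k<?C. f k * (c k)\<^sup>2) = (\<Sum>i<?C. \<Sum>j<?C. g i * ?Z $$ (i, j) * g j)"
        unfolding fz(2)[symmetric] g_def ..
      also have "\<dots> = (\<Sum>i<?C. \<Sum>j<?C. \<Sum>e\<in>E. - (inverse (\<gamma> e) * ((g i * y i e) * (g j * y j e))))"
        by (intro sum.cong refl) (simp add: Zij sum_distrib_left sum_distrib_right sum_negf[symmetric] mult_ac)
      also have "\<dots> = (\<Sum>i<?C. \<Sum>e\<in>E. \<Sum>j<?C. - (inverse (\<gamma> e) * ((g i * y i e) * (g j * y j e))))"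
        by (intro sum.cong refl sum.swap)
      also have "\<dots> = (\<Sum>e\<in>E. \<Sum>i<?C. \<Sum>j<?C. - (inverse (\<gamma> e) * ((g i * y i e) * (g j * y j e))))"
        by (rule sum.swap)
      also have "\<dots> = - (\<Sum>e\<in>E. inverse (\<gamma> e) * (\<Sum>i<?C. g i * y i e)\<^sup>2)"
        unfolding power2_eq_square sum_product unfolding sum_distrib_left sum_negf ..
      finally show ?thesis by (simp add: x g_def)
    qed
    show "\<forall>k<?C. c k = 0" if "\<forall>e\<in>E. (\<Sum>k<?C. c k * x k e) = 0" for c
    proof -
      have "\<forall>i<?C. (\<Sum>k<?C. c k * z k i) = 0"
        using bas(2)[of "\<lambda>i. \<Sum>k<?C. c k * z k i"] that unfolding x by simp
      then show ?thesis by (rule fz(3))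
    qed
    show "(\<Sum>e\<in>E. grad ori w e * x k e) = 0" for k w
    proof -
      have "(\<Sum>e\<in>E. grad ori w e * x k e) = (\<Sum>i<?C. z k i * (\<Sum>e\<in>E. grad ori w e * y i e))"
        unfolding x_def sum_distrib_left by (subst sum.swap) (simp add: mult_ac)
      then show ?thesis using bas(1) by simp
    qed
  qed (rule fz(1))
qed

section \<open>Dimension of the cycle space\<close>

lemma grad_eq_sum_indicators:
  assumes "e \<in> E"
  shows "grad ori w e = (\<Sum>v\<in>V. w v * grad ori (\<lambda>u. if u = v then 1 else 0) e)"
proof -
  have "(\<Sum>v\<in>V. w v * grad ori (\<lambda>u. if u = v then 1 else 0) e)
    = (\<Sum>v\<in>V. (if fst (ori e) = v then w v else 0) - (if snd (ori e) = v then w v else 0))"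
    by (intro sum.cong refl) (auto simp: grad_def)
  also have "\<dots> = grad ori w e"
    using ori_ends[OF assms] finite_V by (simp add: sum_subtractf grad_def)
  finally show ?thesis by simp
qed

lemma grad_rooted:
  assumes "e \<in> E" "r \<in> V" "w r = 0"
  shows "grad ori w e = (\<Sum>v\<in>V - {r}. w v * grad ori (\<lambda>u. if u = v then 1 else 0) e)"
  using grad_eq_sum_indicators[OF assms(1), of w] assms finite_V by (simp add: sum.remove[of V r])

text \<open>Gradients and cycle space are orthogonal complements for the standard inner product, and
  functions vanishing at a root \<open>r\<close> parametrize the gradients injectively. If the
  dimensions added up to more than \<open>card E\<close>, some nontrivial combination of cycles
  would be a gradient, hence orthogonal to itself. If to less, a nonzero \<open>x\<close> would be
  orthogonal to both; it would then lie in the cycle space and again be orthogonal to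
  itself.\<close>

lemma cycle_space_dimension:
  assumes "cycle_fun_basis C y"
  shows "C + card V = card E + 1"
proof -
  note orth = cycle_fun_basisD(1)[OF assms] and indep = cycle_fun_basisD(2)[OF assms]
    and span = cycle_fun_basisD(3)[OF assms]
  let ?\<iota> = "\<lambda>v u. if u = v then 1 else 0 :: real"
  obtain r where r: "r \<in> V" using V_nonempty by auto
  have cV: "card (V - {r}) + 1 = card V" using card_Suc_Diff1[OF finite_V r] by simp
  have "\<not> card E < C + card (V - {r})"
  proof
    assume less: "card E < C + card (V - {r})"
    obtain c g where c: "\<And>k. k \<notin> {..<C} \<Longrightarrow> c k = 0" and g: "\<And>v. v \<notin> V - {r} \<Longrightarrow> g v = 0"
      and nz: "(\<exists>k\<in>{..<C}. c k \<noteq> 0) \<or> (\<exists>v\<in>V - {r}. g v \<noteq> 0)"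
      and sol: "\<And>e. e \<in> E \<Longrightarrow> (\<Sum>k<C. c k * y k e) + (\<Sum>v\<in>V - {r}. g v * grad ori (?\<iota> v) e) = 0"
      by (rule homogeneous_system_supported_solution2[OF finite_E, of "{..<C}" "V - {r}" "{..<C}" "V - {r}"
            "\<lambda>e k. y k e" "\<lambda>e v. grad ori (?\<iota> v) e"])
        (use less finite_V in auto)
    have gr: "g r = 0" using g by simp
    have sol': "(\<Sum>k<C. c k * y k e) = - grad ori g e" if "e \<in> E" for e
      using sol[OF that] grad_rooted[where w = g, OF that r gr] by simp
    have "(\<Sum>e\<in>E. (\<Sum>k<C. c k * y k e)\<^sup>2) = - (\<Sum>e\<in>E. \<Sum>k<C. c k * (grad ori g e * y k e))"
      unfolding sum_negf[symmetric]
    proof (rule sum.cong[OF refl])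
      fix e assume e: "e \<in> E"
      have "(\<Sum>k<C. c k * y k e)\<^sup>2 = - (grad ori g e * (\<Sum>k<C. c k * y k e))"
        by (simp add: sol'[OF e] power2_eq_square)
      also have "\<dots> = (\<Sum>k<C. - (c k * (grad ori g e * y k e)))"
        by (simp only: sum_distrib_left mult.left_commute sum_negf)
      finally show "(\<Sum>k<C. c k * y k e)\<^sup>2 = (\<Sum>k<C. - (c k * (grad ori g e * y k e)))" .
    qed
    also have "(\<Sum>e\<in>E. \<Sum>k<C. c k * (grad ori g e * y k e)) = (\<Sum>k<C. c k * (\<Sum>e\<in>E. grad ori g e * y k e))"
      unfolding sum_distrib_left by (rule sum.swap)
    also have "\<dots> = 0" using orth by simp
    finally have y0: "\<forall>e\<in>E. (\<Sum>k<C. c k * y k e) = 0"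
      using finite_E by (simp add: sum_nonneg_eq_0_iff)
    then have "c k = 0" if "k < C" for k using indep[of c k] that by simp
    moreover have "g v = g r" if "v \<in> V" for v
      using grad_zero_on_connected[OF order_refl conn _ that r] y0 sol' by simp
    then have "g v = 0" if "v \<in> V" for v using that gr by simp
    ultimately show False using nz by auto
  qed
  moreover have "\<not> C + card (V - {r}) < card E"
  proof
    assume less: "C + card (V - {r}) < card E"
    have "card ({..<C} <+> (V - {r})) < card E" using less finite_V by (simp add: card_Plus)
    from homogeneous_system_nonzero_solution[OF _ finite_E this,
        of "\<lambda>j e. case_sum (\<lambda>k. y k e) (\<lambda>v. grad ori (?\<iota> v) e) j"] finite_V
    obtain x where nz: "\<exists>e\<in>E. x e \<noteq> 0"
      and sol: "\<forall>j\<in>{..<C} <+> (V - {r}). (\<Sum>e\<in>E. case_sum (\<lambda>k. y k e) (\<lambda>v. grad ori (?\<iota> v) e) j * x e) = 0"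
      by auto
    have s1: "(\<Sum>e\<in>E. y k e * x e) = 0" if "k < C" for k
      using bspec[OF sol InlI[of k]] that by simp
    have s2: "(\<Sum>e\<in>E. grad ori (?\<iota> v) e * x e) = 0" if "v \<in> V - {r}" for v
      using bspec[OF sol InrI[of v]] that by simp
    have "(\<Sum>e\<in>E. grad ori w e * x e) = 0" for w
    proof -
      let ?w = "\<lambda>v. w v - w r"
      have "(\<Sum>e\<in>E. grad ori w e * x e) = (\<Sum>e\<in>E. grad ori ?w e * x e)" by (simp add: grad_def)
      also have "\<dots> = (\<Sum>e\<in>E. (\<Sum>v\<in>V - {r}. ?w v * grad ori (?\<iota> v) e) * x e)"
        using r by (intro sum.cong refl arg_cong2[where f = "(*)"] grad_rooted) auto
      also have "\<dots> = (\<Sum>v\<in>V - {r}. ?w v * (\<Sum>e\<in>E. grad ori (?\<iota> v) e * x e))"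
        unfolding sum_distrib_left sum_distrib_right by (subst sum.swap) (simp only: mult.assoc)
      also have "\<dots> = 0" using s2 by simp
      finally show ?thesis .
    qed
    then obtain c where c: "\<forall>e\<in>E. x e = (\<Sum>k<C. c k * y k e)" using span[of x] by auto
    have "(\<Sum>e\<in>E. (x e)\<^sup>2) = (\<Sum>e\<in>E. (\<Sum>k<C. c k * y k e) * x e)"
      using c by (intro sum.cong refl) (simp add: power2_eq_square)
    also have "\<dots> = (\<Sum>k<C. c k * (\<Sum>e\<in>E. y k e * x e))"
      unfolding sum_distrib_left sum_distrib_right by (subst sum.swap) (simp only: mult.assoc)
    also have "\<dots> = 0" using s1 by simp
    finally show False using nz finite_E by (simp add: sum_nonneg_eq_0_iff)
  qed
  ultimately show ?thesis using cV by linarith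
qed

end

section \<open>Bases of the cycle space\<close>

text \<open>Distinctness of \<open>ys\<close> lets coefficients on the set and coefficients on the
  list positions be exchanged; vectors outside a chosen subset get coefficient zero.\<close>

lemma kernel_basis_iff:
  fixes A :: "real mat"
  assumes A: "A \<in> carrier_mat nr nc" and d: "distinct ys"
  shows "kernel.basis nc A (set ys) \<longleftrightarrow>
    set ys \<subseteq> mat_kernel A
    \<and> (\<forall>c. (\<forall>j<nc. (\<Sum>k<length ys. c k * ys ! k $ j) = 0) \<longrightarrow> (\<forall>k<length ys. c k = 0))
    \<and> (\<forall>x\<in>mat_kernel A. \<exists>c. \<forall>j<nc. x $ j = (\<Sum>k<length ys. c k * ys ! k $ j))"
    (is "?B \<longleftrightarrow> ?ker \<and> ?indep \<and> ?span")
proof -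
  interpret K: kernel nr nc A using A by unfold_locales
  let ?C = "length ys"
  have sum_ys: "(\<Sum>x\<in>set ys. h x) = (\<Sum>k<?C. h (ys ! k))" for h :: "real vec \<Rightarrow> real"
    using sum_enumerates[of ys "set ys" h] d by (simp add: enumerates_def)
  have lc: "K.lincomb a S $ j = (\<Sum>x\<in>S. a x * x $ j)" if "S \<subseteq> mat_kernel A" "j < nc" for a S j
    using K.lincomb_index[OF that(2,1)] .
  have lc_dim: "K.lincomb a S \<in> carrier_vec nc" if "S \<subseteq> mat_kernel A" for a S
    using K.lincomb_same[OF that] K.NC.lincomb_closed[of S a] that mat_kernel_carrier[OF A] by auto
  have idx: "index_of ys (ys ! k) = k" if "k < ?C" for k using index_of_nth[OF d that] .
  have lin: "\<not> K.lin_dep (set ys) \<longleftrightarrow> ?indep" if ker: ?ker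
  proof
    assume indep: "\<not> K.lin_dep (set ys)"
    show ?indep
    proof (intro allI impI)
      fix c k assume c: "\<forall>j<nc. (\<Sum>k<?C. c k * ys ! k $ j) = 0" and k: "k < ?C"
      let ?a = "\<lambda>x. c (index_of ys x)"
      have "K.lincomb ?a (set ys) = 0\<^sub>v nc"
      proof (rule eq_vecI)
        fix j assume "j < dim_vec (0\<^sub>v nc :: real vec)"
        then have j: "j < nc" by simp
        have "K.lincomb ?a (set ys) $ j = (\<Sum>k<?C. c k * ys ! k $ j)"
          unfolding lc[OF ker j] sum_ys by (intro sum.cong refl) (simp add: idx)
        then show "K.lincomb ?a (set ys) $ j = 0\<^sub>v nc $ j" using c j by simp
      qed (use lc_dim[OF ker] in auto)
      then have "K.lin_dep (set ys)" if "?a (ys ! k) \<noteq> 0"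
        unfolding K.Ker.lin_dep_def using that k
        by (intro exI[of _ "set ys"] exI[of _ ?a] exI[of _ "ys ! k"]) auto
      then have "?a (ys ! k) = 0" using indep by blast
      then show "c k = 0" using idx k by simp
    qed
  next
    assume indep: ?indep
    show "\<not> K.lin_dep (set ys)"
    proof
      assume "K.lin_dep (set ys)"
      then obtain S a v where S: "S \<subseteq> set ys" "K.lincomb a S = 0\<^sub>v nc" "v \<in> S" "a v \<noteq> 0"
        unfolding K.Ker.lin_dep_def by auto
      have SK: "S \<subseteq> mat_kernel A" using S ker by auto
      let ?c = "\<lambda>k. if ys ! k \<in> S then a (ys ! k) else 0"
      have "(\<Sum>k<?C. ?c k * ys ! k $ j) = 0" if "j < nc" for j
      proof -
        have "(\<Sum>k<?C. ?c k * ys ! k $ j) = (\<Sum>x\<in>set ys. (if x \<in> S then a x else 0) * x $ j)"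
          unfolding sum_ys ..
        also have "\<dots> = (\<Sum>x\<in>S. a x * x $ j)"
          using S(1) by (intro sum.mono_neutral_cong_right) auto
        also have "\<dots> = 0" using lc[OF SK that, of a] S(2) that by simp
        finally show ?thesis .
      qed
      then have "\<forall>j<nc. (\<Sum>k<?C. ?c k * ys ! k $ j) = 0" by simp
      then have "\<forall>k<?C. ?c k = 0" by (rule indep[THEN spec, THEN mp])
      moreover obtain k where "k < ?C" "ys ! k = v" using S by (metis in_set_conv_nth subsetD)
      ultimately show False using S by auto
    qed
  qed
  have span: "K.span (set ys) = mat_kernel A \<longleftrightarrow> ?span" if ker: ?ker
  proof
    assume sp: "K.span (set ys) = mat_kernel A"
    show ?span
    proof
      fix x assume "x \<in> mat_kernel A"
      then have "x \<in> K.span (set ys)" using sp by simp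
      then obtain a S where S: "S \<subseteq> set ys" "x = K.lincomb a S"
        unfolding K.Ker.span_def by auto
      have SK: "S \<subseteq> mat_kernel A" using S ker by auto
      let ?c = "\<lambda>k. if ys ! k \<in> S then a (ys ! k) else 0"
      have "x $ j = (\<Sum>k<?C. ?c k * ys ! k $ j)" if "j < nc" for j
      proof -
        have "(\<Sum>k<?C. ?c k * ys ! k $ j) = (\<Sum>x\<in>set ys. (if x \<in> S then a x else 0) * x $ j)"
          unfolding sum_ys ..
        also have "\<dots> = (\<Sum>x\<in>S. a x * x $ j)"
          using S(1) by (intro sum.mono_neutral_cong_right) auto
        finally show ?thesis using lc[OF SK that, of a] S(2) by simp
      qed
      then show "\<exists>c. \<forall>j<nc. x $ j = (\<Sum>k<?C. c k * ys ! k $ j)" by (intro exI[of _ ?c]) simp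
    qed
  next
    assume sp: ?span
    show "K.span (set ys) = mat_kernel A"
    proof (intro equalityI subsetI)
      fix x assume "x \<in> K.span (set ys)"
      then show "x \<in> mat_kernel A" using K.Ker.span_is_subset2[OF ker] by auto
    next
      fix x assume x: "x \<in> mat_kernel A"
      then obtain c where c: "\<forall>j<nc. x $ j = (\<Sum>k<?C. c k * ys ! k $ j)" using sp by auto
      let ?a = "\<lambda>x. c (index_of ys x)"
      have "x = K.lincomb ?a (set ys)"
      proof (rule eq_vecI)
        fix j assume "j < dim_vec (K.lincomb ?a (set ys))"
        then have j: "j < nc" using lc_dim[OF ker, of ?a] by simp
        have "K.lincomb ?a (set ys) $ j = (\<Sum>k<?C. c k * ys ! k $ j)"
          unfolding lc[OF ker j] sum_ys by (intro sum.cong refl) (simp add: idx)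
        then show "x $ j = K.lincomb ?a (set ys) $ j" using c j by simp
      qed (use carrier_vecD[OF lc_dim[OF ker, of ?a]] mat_kernelD(1)[OF A x] in simp)
      then show "x \<in> K.span (set ys)" unfolding K.Ker.span_def by auto
    qed
  qed
  have "?B \<longleftrightarrow> ?ker \<and> \<not> K.lin_dep (set ys) \<and> K.span (set ys) = mat_kernel A"
    unfolding K.Ker.basis_def by auto
  then show ?thesis using lin span by blast
qed

context connected_graph
begin

text \<open>A row of the incidence matrix is the gradient of the indicator of a vertex, and these
  gradients span all gradients: \<open>grad\<close> is the transpose of the incidence
  matrix.\<close>

lemma incidence_kernel_iff:
  assumes vs: "enumerates vs V" and es: "enumerates es E" and x: "x \<in> carrier_vec (length es)"
  shows "x \<in> mat_kernel (incidence_matrix vs es ori)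
    \<longleftrightarrow> (\<forall>w. (\<Sum>e\<in>E. grad ori w e * x $ index_of es e) = 0)"
proof -
  let ?B = "incidence_matrix vs es ori" and ?n = "length vs" and ?m = "length es"
  have B: "?B \<in> carrier_mat ?n ?m" by (simp add: incidence_matrix_def)
  have Bx: "(?B *\<^sub>v x) $ i = (\<Sum>e\<in>E. grad ori (\<lambda>u. if u = vs ! i then 1 else 0) e * x $ index_of es e)"
    if i: "i < ?n" for i
  proof -
    have "(?B *\<^sub>v x) $ i = (\<Sum>l<?m. grad ori (\<lambda>u. if u = vs ! i then 1 else 0) (es ! l) * x $ l)"
    proof -
      have "?B $$ (i, l) = grad ori (\<lambda>u. if u = vs ! i then 1 else 0) (es ! l)" if l: "l < ?m" for l
      proof -
        have "es ! l \<in> E" using l es by (auto simp: enumerates_def)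
        then have "fst (ori (es ! l)) \<noteq> snd (ori (es ! l))" using ori_ends by blast
        then show ?thesis using i l by (auto simp: incidence_matrix_def grad_def)
      qed
      then show ?thesis using i x B by (simp add: scalar_prod_def atLeast0LessThan)
    qed
    also have "\<dots> = (\<Sum>l<?m. grad ori (\<lambda>u. if u = vs ! i then 1 else 0) (es ! l) * x $ index_of es (es ! l))"
      using es by (intro sum.cong refl) (simp add: index_of_nth enumerates_def)
    also have "\<dots> = (\<Sum>e\<in>E. grad ori (\<lambda>u. if u = vs ! i then 1 else 0) e * x $ index_of es e)"
      by (rule sum_enumerates[OF es])
    finally show ?thesis .
  qed
  have "x \<in> mat_kernel ?B \<longleftrightarrow> (\<forall>i<?n. (?B *\<^sub>v x) $ i = 0)"
    unfolding mat_kernel[OF B] using x B by (auto simp del: index_mult_mat_vec intro!: eq_vecI)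
  also have "\<dots> \<longleftrightarrow> (\<forall>v\<in>V. (\<Sum>e\<in>E. grad ori (\<lambda>u. if u = v then 1 else 0) e * x $ index_of es e) = 0)"
  proof -
    have "V = set vs" using vs by (simp add: enumerates_def)
    then show ?thesis using Bx by (simp add: all_set_conv_all_nth del: index_mult_mat_vec)
  qed
  also have "\<dots> \<longleftrightarrow> (\<forall>w. (\<Sum>e\<in>E. grad ori w e * x $ index_of es e) = 0)"
  proof (intro iffI allI)
    fix w assume *: "\<forall>v\<in>V. (\<Sum>e\<in>E. grad ori (\<lambda>u. if u = v then 1 else 0) e * x $ index_of es e) = 0"
    have "(\<Sum>e\<in>E. grad ori w e * x $ index_of es e)
      = (\<Sum>e\<in>E. (\<Sum>v\<in>V. w v * grad ori (\<lambda>u. if u = v then 1 else 0) e) * x $ index_of es e)"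
      by (intro sum.cong refl arg_cong2[where f = "(*)"] grad_eq_sum_indicators)
    also have "\<dots> = (\<Sum>v\<in>V. w v * (\<Sum>e\<in>E. grad ori (\<lambda>u. if u = v then 1 else 0) e * x $ index_of es e))"
      unfolding sum_distrib_left sum_distrib_right by (subst sum.swap) (simp only: mult.assoc)
    also have "\<dots> = 0" using * by simp
    finally show "(\<Sum>e\<in>E. grad ori w e * x $ index_of es e) = 0" .
  qed auto
  finally show ?thesis .
qed

text \<open>Frees the notion of basis from matrices and enumerations, so that all further arguments
  are about functions on edges.\<close>

lemma cycle_space_basis_iff:
  assumes vs: "enumerates vs V" and es: "enumerates es E"
  shows "cycle_space_basis vs es ori ys \<longleftrightarrow> set ys \<subseteq> carrier_vec (length es)
    \<and> cycle_fun_basis (length ys) (\<lambda>k e. ys ! k $ index_of es e)"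
proof -
  let ?B = "incidence_matrix vs es ori" and ?n = "length vs" and ?m = "length es" and ?C = "length ys"
  define y where "y k e = ys ! k $ index_of es e" for k e
  have ynth: "ys ! k $ l = y k (es ! l)" if "l < ?m" for k l
    using that es by (simp add: y_def index_of_nth enumerates_def)
  have B: "?B \<in> carrier_mat ?n ?m" by (simp add: incidence_matrix_def)
  have all_es: "(\<forall>l<?m. Q (es ! l)) \<longleftrightarrow> (\<forall>e\<in>E. Q e)" for Q
  proof -
    have "E = set es" using es by (simp add: enumerates_def)
    then show ?thesis by (simp add: all_set_conv_all_nth)
  qed
  have idx: "index_of es e < ?m" "es ! index_of es e = e" if "e \<in> E" for e
    using that es index_of_nth[of es] by (auto simp: enumerates_def in_set_conv_nth)
  have ker: "set ys \<subseteq> mat_kernel ?B \<longleftrightarrow> (\<forall>k<?C. \<forall>w. (\<Sum>e\<in>E. grad ori w e * y k e) = 0)"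
    if "set ys \<subseteq> carrier_vec ?m"
  proof -
    have "set ys \<subseteq> mat_kernel ?B \<longleftrightarrow> (\<forall>k<?C. ys ! k \<in> mat_kernel ?B)"
      by (auto simp: subset_code(1) all_set_conv_all_nth)
    moreover have "ys ! k \<in> mat_kernel ?B \<longleftrightarrow> (\<forall>w. (\<Sum>e\<in>E. grad ori w e * y k e) = 0)" if "k < ?C" for k
      unfolding y_def
      by (rule incidence_kernel_iff[OF vs es]) (use that \<open>set ys \<subseteq> carrier_vec ?m\<close> nth_mem in blast)
    ultimately show ?thesis by simp
  qed
  have indep: "(\<forall>c. (\<forall>l<?m. (\<Sum>k<?C. c k * ys ! k $ l) = 0) \<longrightarrow> (\<forall>k<?C. c k = 0))
    \<longleftrightarrow> (\<forall>c. (\<forall>e\<in>E. (\<Sum>k<?C. c k * y k e) = 0) \<longrightarrow> (\<forall>k<?C. c k = 0))"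
    unfolding all_es[symmetric] by (simp add: ynth)
  have span: "(\<forall>x\<in>mat_kernel ?B. \<exists>c. \<forall>l<?m. x $ l = (\<Sum>k<?C. c k * ys ! k $ l))
    \<longleftrightarrow> (\<forall>x. (\<forall>w. (\<Sum>e\<in>E. grad ori w e * x e) = 0) \<longrightarrow> (\<exists>c. \<forall>e\<in>E. x e = (\<Sum>k<?C. c k * y k e)))"
  proof (intro iffI allI impI ballI)
    fix x assume *: "\<forall>x\<in>mat_kernel ?B. \<exists>c. \<forall>l<?m. x $ l = (\<Sum>k<?C. c k * ys ! k $ l)"
      and x: "\<forall>w. (\<Sum>e\<in>E. grad ori w e * x e) = 0"
    let ?x = "vec ?m (\<lambda>l. x (es ! l))"
    have "?x $ index_of es e = x e" if "e \<in> E" for e using idx[OF that] by simp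
    then have "?x \<in> mat_kernel ?B" using x by (subst incidence_kernel_iff[OF vs es]) auto
    then obtain c where "\<forall>l<?m. ?x $ l = (\<Sum>k<?C. c k * ys ! k $ l)" using * by blast
    then have "\<forall>l<?m. x (es ! l) = (\<Sum>k<?C. c k * y k (es ! l))" by (simp add: ynth)
    then have "\<forall>e\<in>E. x e = (\<Sum>k<?C. c k * y k e)" by (rule all_es[THEN iffD1])
    then show "\<exists>c. \<forall>e\<in>E. x e = (\<Sum>k<?C. c k * y k e)" by (intro exI[of _ c])
  next
    fix x assume *: "\<forall>x. (\<forall>w. (\<Sum>e\<in>E. grad ori w e * x e) = 0) \<longrightarrow> (\<exists>c. \<forall>e\<in>E. x e = (\<Sum>k<?C. c k * y k e))"
      and x: "x \<in> mat_kernel ?B"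
    have "\<forall>w. (\<Sum>e\<in>E. grad ori w e * x $ index_of es e) = 0"
      using x incidence_kernel_iff[OF vs es] mat_kernelD(1)[OF B x] by blast
    then obtain c where c: "\<forall>e\<in>E. x $ index_of es e = (\<Sum>k<?C. c k * y k e)"
      using *[rule_format, of "\<lambda>e. x $ index_of es e"] by auto
    have "x $ l = (\<Sum>k<?C. c k * ys ! k $ l)" if "l < ?m" for l
      using c[unfolded all_es[symmetric], rule_format, OF that] that es
      by (simp add: ynth index_of_nth enumerates_def)
    then show "\<exists>c. \<forall>l<?m. x $ l = (\<Sum>k<?C. c k * ys ! k $ l)" by blast
  qed
  \<comment> \<open>A repeated vector would satisfy the nontrivial relation with coefficients 1 and
    -1 at its two positions.\<close>
  have dist: "distinct ys" if "cycle_fun_basis ?C y"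
  proof (rule ccontr)
    assume "\<not> distinct ys"
    then obtain i j where ij: "i < ?C" "j < ?C" "i \<noteq> j" "ys ! i = ys ! j" by (auto simp: distinct_conv_nth)
    let ?c = "\<lambda>k. (if k = i then 1 else 0) - (if k = j then 1 else 0) :: real"
    have "(\<Sum>k<?C. ?c k * y k e) = 0" for e
    proof -
      have "(\<Sum>k<?C. ?c k * y k e) = (\<Sum>k<?C. (if k = i then y i e else 0) - (if k = j then y j e else 0))"
        by (intro sum.cong refl) auto
      also have "\<dots> = y i e - y j e" using ij by (simp add: sum_subtractf)
      finally show ?thesis using ij by (simp add: y_def)
    qed
    then have "?c i = 0" using cycle_fun_basisD(2)[OF that, of ?c i] ij by blast
    then show False using ij by simp
  qed
  show ?thesis
    unfolding y_def[symmetric]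
  proof
    assume *: "cycle_space_basis vs es ori ys"
    then have d: "distinct ys" by (simp add: cycle_space_basis_def)
    note iff = kernel_basis_iff[OF B d, unfolded indep span]
    have K: "kernel.basis ?m ?B (set ys)" using * by (simp add: cycle_space_basis_def)
    have "set ys \<subseteq> mat_kernel ?B" using K[unfolded iff] by (rule conjunct1)
    moreover from this have carrier: "set ys \<subseteq> carrier_vec ?m" using mat_kernel_carrier[OF B] by (rule subset_trans)
    ultimately show "set ys \<subseteq> carrier_vec ?m \<and> cycle_fun_basis ?C y"
      using K[unfolded iff ker[OF carrier]] unfolding cycle_fun_basis_def by (intro conjI[OF carrier])
  next
    assume *: "set ys \<subseteq> carrier_vec ?m \<and> cycle_fun_basis ?C y"
    then have d: "distinct ys" using dist by simp
    show "cycle_space_basis vs es ori ys"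
      unfolding cycle_space_basis_def kernel_basis_iff[OF B d, unfolded indep span]
      using * d unfolding ker[OF conjunct1[OF *]] cycle_fun_basis_def by simp
  qed
qed

end

section \<open>Inertia formula and stability\<close>

context connected_graph
begin

text \<open>The spectral data \<open>d, u\<close> and \<open>f, x\<close> diagonalize minus the form on the gradients and on the
  vectors \<open>X e / \<gamma> e\<close>.\<close>

lemma inertia_balance:
  fixes d f :: "nat \<Rightarrow> real" and u :: "nat \<Rightarrow> 'v \<Rightarrow> real" and x :: "nat \<Rightarrow> 'v set \<Rightarrow> real"
  assumes nz: "\<forall>e\<in>E. \<gamma> e \<noteq> 0" and dim: "C + n = card E + 1"
    and u_form: "\<And>c. (\<Sum>e\<in>E. \<gamma> e * (grad ori (\<lambda>v. \<Sum>k<n. c k * u k v) e)\<^sup>2) = - (\<Sum>k<n. d k * (c k)\<^sup>2)"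
    and u_inj: "\<And>c. (\<forall>v\<in>V. (\<Sum>k<n. c k * u k v) = 0) \<Longrightarrow> \<forall>k<n. c k = 0"
    and x_form: "\<And>c. (\<Sum>e\<in>E. inverse (\<gamma> e) * (\<Sum>k<C. c k * x k e)\<^sup>2) = - (\<Sum>k<C. f k * (c k)\<^sup>2)"
    and x_inj: "\<And>c. (\<forall>e\<in>E. (\<Sum>k<C. c k * x k e) = 0) \<Longrightarrow> \<forall>k<C. c k = 0"
    and x_orth: "\<And>k w. (\<Sum>e\<in>E. grad ori w e * x k e) = 0"
  shows "card {e \<in> E. \<gamma> e < 0} = card {k. k < n \<and> 0 < d k} + card {k. k < C \<and> 0 \<le> f k}"
proof -
  let ?w = "\<lambda>c v. \<Sum>k<n. c k * u k v" and ?X = "\<lambda>g e. \<Sum>k<C. g k * x k e"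
  let ?P = "{e \<in> E. 0 < \<gamma> e}" and ?N = "{e \<in> E. \<gamma> e < 0}"
  let ?A = "{k. k < n \<and> 0 < d k}" and ?A' = "{k. k < n \<and> d k \<le> 0}"
  let ?F = "{k. k < C \<and> 0 \<le> f k}" and ?F' = "{k. k < C \<and> f k < 0}"
  \<comment> \<open>In the mixed term \<open>\<gamma>\<close> cancels, which leaves the pairing of a
    gradient with an element of the cycle space.\<close>
  have form: "(\<Sum>e\<in>E. \<gamma> e * (grad ori (?w c) e + ?X g e / \<gamma> e)\<^sup>2)
      = - (\<Sum>k<n. d k * (c k)\<^sup>2) - (\<Sum>k<C. f k * (g k)\<^sup>2)" for c g
  proof -
    have "(\<Sum>e\<in>E. grad ori (?w c) e * ?X g e) = (\<Sum>k<C. g k * (\<Sum>e\<in>E. grad ori (?w c) e * x k e))"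
      unfolding sum_distrib_left by (subst sum.swap) (simp only: mult.left_commute)
    also have "\<dots> = 0" by (simp add: x_orth)
    finally have cross: "(\<Sum>e\<in>E. grad ori (?w c) e * ?X g e) = 0" .
    have "(\<Sum>e\<in>E. \<gamma> e * (grad ori (?w c) e + ?X g e / \<gamma> e)\<^sup>2)
      = (\<Sum>e\<in>E. \<gamma> e * (grad ori (?w c) e)\<^sup>2 + 2 * (grad ori (?w c) e * ?X g e) + inverse (\<gamma> e) * (?X g e)\<^sup>2)"
    proof (rule sum.cong[OF refl])
      fix e assume "e \<in> E"
      then have "\<gamma> e \<noteq> 0" using nz by blast
      then have "\<gamma> e * (a + b / \<gamma> e)\<^sup>2 = \<gamma> e * a\<^sup>2 + 2 * (a * b) + inverse (\<gamma> e) * b\<^sup>2" for a b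
        by (simp add: power2_eq_square field_simps)
      then show "\<gamma> e * (grad ori (?w c) e + ?X g e / \<gamma> e)\<^sup>2
        = \<gamma> e * (grad ori (?w c) e)\<^sup>2 + 2 * (grad ori (?w c) e * ?X g e) + inverse (\<gamma> e) * (?X g e)\<^sup>2" .
    qed
    also have "\<dots> = - (\<Sum>k<n. d k * (c k)\<^sup>2) - (\<Sum>k<C. f k * (g k)\<^sup>2)"
      unfolding sum.distrib sum_distrib_left[symmetric] cross u_form x_form by simp
    finally show ?thesis .
  qed
  have N_le: "card ?N \<le> card ?A + card ?F"
  proof (rule ccontr)
    assume "\<not> card ?N \<le> card ?A + card ?F"
    moreover have "card ?A + card ?A' = n"
    proof -
      have "card ?A + card ?A' = card (?A \<union> ?A')" by (rule card_Un_disjoint[symmetric]) auto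
      also have "?A \<union> ?A' = {..<n}" by auto
      finally show ?thesis by simp
    qed
    moreover have "card ?F + card ?F' = C"
    proof -
      have "card ?F + card ?F' = card (?F \<union> ?F')" by (rule card_Un_disjoint[symmetric]) auto
      also have "?F \<union> ?F' = {..<C}" by auto
      finally show ?thesis by simp
    qed
    moreover have "card ?P + card ?N = card E"
    proof -
      have "card ?P + card ?N = card (?P \<union> ?N)" using finite_E by (intro card_Un_disjoint[symmetric]) auto
      also have "?P \<union> ?N = E" using nz by force
      finally show ?thesis by simp
    qed
    moreover have "card (insert None (Some ` ?P)) = card ?P + 1"
      using finite_E by (simp add: card_image)
    \<comment> \<open>By \<open>dim\<close> there are \<open>card E + 1 - card ?A - card ?F\<close>
      unknowns, more than the \<open>card E - card ?N + 1\<close> equations.\<close>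
    ultimately have less: "card (insert None (Some ` ?P)) < card ?A' + card ?F'" using dim by linarith
    \<comment> \<open>The rows \<open>Some e\<close> make the edge vector vanish on the positive
      edges. The row \<open>None\<close> asks that \<open>w\<close> sum to zero over
      \<open>V\<close>, which excludes the constants that no gradient detects.\<close>
    let ?a = "\<lambda>j k. case j of None \<Rightarrow> \<Sum>v\<in>V. u k v | Some e \<Rightarrow> grad ori (u k) e"
    let ?b = "\<lambda>j k. case j of None \<Rightarrow> 0 | Some e \<Rightarrow> x k e / \<gamma> e"
    have fJ: "finite (insert None (Some ` ?P))" using finite_E by simp
    have sub: "?A' \<subseteq> {..<n}" "?F' \<subseteq> {..<C}" by auto
    obtain c g where c0: "\<And>i. i \<notin> ?A' \<Longrightarrow> c i = 0" and g0: "\<And>k. k \<notin> ?F' \<Longrightarrow> g k = 0"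
      and cg: "(\<exists>i\<in>?A'. c i \<noteq> 0) \<or> (\<exists>k\<in>?F'. g k \<noteq> 0)"
      and sol: "\<And>j. j \<in> insert None (Some ` ?P) \<Longrightarrow> (\<Sum>i<n. c i * ?a j i) + (\<Sum>k<C. g k * ?b j k) = 0"
      by (rule homogeneous_system_supported_solution2[OF fJ finite_lessThan finite_lessThan sub less, of ?a ?b])
        (rule that)
    have solP: "grad ori (?w c) e + ?X g e / \<gamma> e = 0" if "e \<in> ?P" for e
      using sol[of "Some e"] that by (simp add: grad_sum sum_divide_distrib)
    have "(\<Sum>v\<in>V. ?w c v) = (\<Sum>i<n. c i * (\<Sum>v\<in>V. u i v))"
      unfolding sum_distrib_left by (rule sum.swap)
    then have sum0: "(\<Sum>v\<in>V. ?w c v) = 0" using sol[of None] by simp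
    have c_nonneg: "0 \<le> - (d k * (c k)\<^sup>2)" for k
      using c0[of k] by (cases "k \<in> ?A'") (auto simp: mult_nonpos_nonneg)
    have g_nonneg: "0 \<le> - (f k * (g k)\<^sup>2)" for k
      using g0[of k] by (cases "k \<in> ?F'") (auto simp: mult_nonpos_nonneg)
    have t: "0 \<le> - (\<gamma> e * (grad ori (?w c) e + ?X g e / \<gamma> e)\<^sup>2)" if "e \<in> E" for e
      using solP[of e] that nz by (cases "e \<in> ?P") (auto simp: not_less mult_nonpos_nonneg)
    have "0 \<le> (\<Sum>k<n. - (d k * (c k)\<^sup>2))" "0 \<le> (\<Sum>k<C. - (f k * (g k)\<^sup>2))"
      "0 \<le> (\<Sum>e\<in>E. - (\<gamma> e * (grad ori (?w c) e + ?X g e / \<gamma> e)\<^sup>2))"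
      by (auto intro!: sum_nonneg simp only: c_nonneg g_nonneg t)
    moreover have "(\<Sum>e\<in>E. - (\<gamma> e * (grad ori (?w c) e + ?X g e / \<gamma> e)\<^sup>2))
      + (\<Sum>k<n. - (d k * (c k)\<^sup>2)) + (\<Sum>k<C. - (f k * (g k)\<^sup>2)) = 0"
      unfolding sum_negf form by simp
    ultimately have zero: "(\<Sum>k<C. - (f k * (g k)\<^sup>2)) = 0"
      "(\<Sum>e\<in>E. - (\<gamma> e * (grad ori (?w c) e + ?X g e / \<gamma> e)\<^sup>2)) = 0" by linarith+
    have fg: "\<forall>k\<in>{..<C}. - (f k * (g k)\<^sup>2) = 0"
      using zero(1) g_nonneg by (subst (asm) sum_nonneg_eq_0_iff) auto
    \<comment> \<open>On the support of \<open>g\<close> the \<open>f k\<close> are strictly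
      negative, which settles \<open>g\<close>. On the support of \<open>c\<close> some
      \<open>d k\<close> may be zero, so \<open>c\<close> is treated through the vanishing gradient
      and the normalization of \<open>w\<close>.\<close>
    have g: "g k = 0" for k using g0[of k] bspec[OF fg, of k] by (cases "k \<in> ?F'") auto
    have "\<forall>e\<in>E. - (\<gamma> e * (grad ori (?w c) e + ?X g e / \<gamma> e)\<^sup>2) = 0"
      using zero(2) t finite_E by (subst (asm) sum_nonneg_eq_0_iff) auto
    then have "grad ori (?w c) e = 0" if "e \<in> E" for e using that nz g by auto
    then have const: "?w c v = ?w c v'" if "v \<in> V" "v' \<in> V" for v v'
      using grad_zero_on_connected[OF order_refl conn _ that, of "?w c"] by simp
    have "?w c v = 0" if v: "v \<in> V" for v
    proof -
      have "(\<Sum>v'\<in>V. ?w c v') = (\<Sum>v'\<in>V. ?w c v)" by (rule sum.cong[OF refl]) (rule const[OF _ v])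
      then have "of_nat (card V) * ?w c v = 0" using sum0 by simp
      then show ?thesis using finite_V V_nonempty by simp
    qed
    then have "\<forall>k<n. c k = 0" using u_inj by blast
    then show False using cg g by auto
  qed
  \<comment> \<open>The signs are exchanged: the edge vector vanishes on the negative edges, strict
    positivity of \<open>d\<close> settles \<open>c\<close>, and the zero eigenvalues among the
    \<open>f k\<close> are covered by the injectivity of \<open>x\<close>.\<close>
  have N_ge: "card ?A + card ?F \<le> card ?N"
  proof (rule ccontr)
    assume "\<not> card ?A + card ?F \<le> card ?N"
    then have less: "card ?N < card ?A + card ?F" by simp
    have fJ: "finite ?N" using finite_E by simp
    have sub: "?A \<subseteq> {..<n}" "?F \<subseteq> {..<C}" by auto
    let ?a = "\<lambda>e k. grad ori (u k) e" and ?b = "\<lambda>e k. x k e / \<gamma> e"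
    obtain c g where c0: "\<And>i. i \<notin> ?A \<Longrightarrow> c i = 0" and g0: "\<And>k. k \<notin> ?F \<Longrightarrow> g k = 0"
      and cg: "(\<exists>i\<in>?A. c i \<noteq> 0) \<or> (\<exists>k\<in>?F. g k \<noteq> 0)"
      and sol: "\<And>j. j \<in> ?N \<Longrightarrow> (\<Sum>i<n. c i * ?a j i) + (\<Sum>k<C. g k * ?b j k) = 0"
      by (rule homogeneous_system_supported_solution2[OF fJ finite_lessThan finite_lessThan sub less, of ?a ?b])
        (rule that)
    have solN: "grad ori (?w c) e + ?X g e / \<gamma> e = 0" if "e \<in> ?N" for e
      using sol[of e] that by (simp add: grad_sum sum_divide_distrib)
    have c_nonneg: "0 \<le> d k * (c k)\<^sup>2" for k
      using c0[of k] by (cases "k \<in> ?A") auto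
    have g_nonneg: "0 \<le> f k * (g k)\<^sup>2" for k
      using g0[of k] by (cases "k \<in> ?F") auto
    have t: "0 \<le> \<gamma> e * (grad ori (?w c) e + ?X g e / \<gamma> e)\<^sup>2" if "e \<in> E" for e
      using solN[of e] that nz by (cases "e \<in> ?N") (auto simp: not_less)
    have "0 \<le> (\<Sum>k<n. d k * (c k)\<^sup>2)" "0 \<le> (\<Sum>k<C. f k * (g k)\<^sup>2)"
      "0 \<le> (\<Sum>e\<in>E. \<gamma> e * (grad ori (?w c) e + ?X g e / \<gamma> e)\<^sup>2)"
      by (auto intro!: sum_nonneg simp only: c_nonneg g_nonneg t)
    then have zero: "(\<Sum>k<n. d k * (c k)\<^sup>2) = 0"
      "(\<Sum>e\<in>E. \<gamma> e * (grad ori (?w c) e + ?X g e / \<gamma> e)\<^sup>2) = 0"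
      unfolding form by linarith+
    have dc: "\<forall>k\<in>{..<n}. d k * (c k)\<^sup>2 = 0"
      using zero(1) c_nonneg by (subst (asm) sum_nonneg_eq_0_iff) auto
    have c: "c k = 0" for k using c0[of k] bspec[OF dc, of k] by (cases "k \<in> ?A") auto
    have "\<forall>e\<in>E. \<gamma> e * (grad ori (?w c) e + ?X g e / \<gamma> e)\<^sup>2 = 0"
      using zero(2) t finite_E by (subst (asm) sum_nonneg_eq_0_iff) auto
    then have "?X g e = 0" if "e \<in> E" for e using that nz c by (auto simp: grad_def)
    then have "\<forall>k<C. g k = 0" using x_inj by blast
    then show False using cg c by auto
  qed
  show ?thesis using N_le N_ge by linarith
qed

lemma n_pos_laplacian_eq:
  assumes nz: "\<forall>e\<in>E. \<gamma> e \<noteq> 0" and vs: "enumerates vs V" and es: "enumerates es E"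
    and ys: "cycle_space_basis vs es ori ys"
  shows "card (negative_edges E \<gamma>) = n_pos (laplacian vs E \<gamma>)
    + (n_pos (cycle_intersection_matrix es \<gamma> ys) + n_zero (cycle_intersection_matrix es \<gamma> ys))"
proof -
  let ?n = "length vs" and ?C = "length ys"
  have carrier: "set ys \<subseteq> carrier_vec (length es)"
    and basis: "cycle_fun_basis ?C (\<lambda>k e. ys ! k $ index_of es e)"
    using ys cycle_space_basis_iff[OF vs es] by blast+
  have dim: "?C + ?n = card E + 1"
    using cycle_space_dimension[OF basis] enumerates_length[OF vs] by simp
  obtain d and u :: "nat \<Rightarrow> 'v \<Rightarrow> real" where du:
    "\<And>P. eigenvalue_count P (laplacian vs E \<gamma>) = card {k. k < ?n \<and> P (d k)}"
    "\<And>c. (\<Sum>e\<in>E. \<gamma> e * (grad ori (\<lambda>v. \<Sum>k<?n. c k * u k v) e)\<^sup>2) = - (\<Sum>k<?n. d k * (c k)\<^sup>2)"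
    "\<And>c. (\<forall>v\<in>V. (\<Sum>k<?n. c k * u k v) = 0) \<Longrightarrow> \<forall>k<?n. c k = 0"
    "\<And>w. \<exists>c. \<forall>v\<in>V. w v = (\<Sum>k<?n. c k * u k v)"
    by (rule laplacian_inertia[OF vs, of \<gamma>]) (rule that)
  obtain f and x :: "nat \<Rightarrow> 'v set \<Rightarrow> real" where fx:
    "\<And>P. eigenvalue_count P (cycle_intersection_matrix es \<gamma> ys) = card {k. k < ?C \<and> P (f k)}"
    "\<And>c. (\<Sum>e\<in>E. inverse (\<gamma> e) * (\<Sum>k<?C. c k * x k e)\<^sup>2) = - (\<Sum>k<?C. f k * (c k)\<^sup>2)"
    "\<And>c. (\<forall>e\<in>E. (\<Sum>k<?C. c k * x k e) = 0) \<Longrightarrow> \<forall>k<?C. c k = 0"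
    "\<And>k w. (\<Sum>e\<in>E. grad ori w e * x k e) = 0"
    by (rule cycle_intersection_inertia[OF es carrier basis, of \<gamma>]) (rule that)
  have "card {k. k < ?C \<and> 0 < f k} + card {k. k < ?C \<and> f k = 0}
    = card ({k. k < ?C \<and> 0 < f k} \<union> {k. k < ?C \<and> f k = 0})"
    by (rule card_Un_disjoint[symmetric]) auto
  also have "{k. k < ?C \<and> 0 < f k} \<union> {k. k < ?C \<and> f k = 0} = {k. k < ?C \<and> 0 \<le> f k}" by auto
  finally show ?thesis
    unfolding n_pos_def n_zero_def du(1) fx(1) negative_edges_def
    using inertia_balance[OF nz dim du(2,3) fx(2-4)] by simp
qed

lemma n_pos_zero_neg_sum:
  assumes "A \<in> carrier_mat n n" and "transpose_mat A = A"
  shows "n_pos A + n_zero A + n_neg A = n"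
proof -
  obtain U d where U: "U \<in> carrier_mat n n" and UU: "transpose_mat U * U = 1\<^sub>m n"
    and D: "transpose_mat U * A * U = mat_diag n d"
    using symmetric_real_mat_diagonalization[OF assms] by auto
  note count = eigenvalue_count_diagonalized[OF assms(1) U UU D]
  have "n_pos A + n_zero A + n_neg A
    = card ({k. k < n \<and> 0 < d k} \<union> {k. k < n \<and> d k = 0} \<union> {k. k < n \<and> d k < 0})"
    unfolding n_pos_def n_zero_def n_neg_def count
    by (subst card_Un_disjoint; (subst card_Un_disjoint)?) auto
  also have "{k. k < n \<and> 0 < d k} \<union> {k. k < n \<and> d k = 0} \<union> {k. k < n \<and> d k < 0} = {..<n}" by auto
  finally show ?thesis by simp
qed

text \<open>Applying the formula for \<open>n_pos\<close> of the Laplacian to both \<open>\<gamma>\<close> and \<open>- \<gamma>\<close> shows that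
  \<open>n_pos Z + n_zero Z\<close> and \<open>n_neg Z + n_zero Z\<close> do not depend on the basis.\<close>

lemma mat_index_basis_independent:
  assumes nz: "\<forall>e\<in>E. \<gamma> e \<noteq> 0" and vs: "enumerates vs V" and es: "enumerates es E"
    and ys: "cycle_space_basis vs es ori ys" "cycle_space_basis vs es ori ys'"
  shows "mat_index (cycle_intersection_matrix es \<gamma> ys) = mat_index (cycle_intersection_matrix es \<gamma> ys')"
proof -
  have nz': "\<forall>e\<in>E. - \<gamma> e \<noteq> 0" using nz by simp
  have sums: "n_pos (cycle_intersection_matrix es \<gamma> zs) + n_zero (cycle_intersection_matrix es \<gamma> zs)
        + n_neg (cycle_intersection_matrix es \<gamma> zs) = length zs"
    "card (negative_edges E (\<lambda>e. - \<gamma> e)) = n_pos (laplacian vs E (\<lambda>e. - \<gamma> e))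
      + (n_neg (cycle_intersection_matrix es \<gamma> zs) + n_zero (cycle_intersection_matrix es \<gamma> zs))"
    "length zs + card V = card E + 1"
    if "cycle_space_basis vs es ori zs" for zs
  proof -
    let ?Z = "cycle_intersection_matrix es \<gamma> zs"
    have carrier: "set zs \<subseteq> carrier_vec (length es)"
      and basis: "cycle_fun_basis (length zs) (\<lambda>k e. zs ! k $ index_of es e)"
      using that cycle_space_basis_iff[OF vs es] by blast+
    note Z = cycle_intersection_matrix_carrier[of es \<gamma> zs] cycle_intersection_matrix_symmetric[OF carrier, of \<gamma>]
    show "n_pos ?Z + n_zero ?Z + n_neg ?Z = length zs" by (rule n_pos_zero_neg_sum[OF Z])
    have "n_pos (- ?Z) = n_neg ?Z" "n_zero (- ?Z) = n_zero ?Z"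
      unfolding n_pos_def n_neg_def n_zero_def eigenvalue_count_uminus[OF Z] by simp_all
    then show "card (negative_edges E (\<lambda>e. - \<gamma> e)) = n_pos (laplacian vs E (\<lambda>e. - \<gamma> e)) + (n_neg ?Z + n_zero ?Z)"
      using n_pos_laplacian_eq[OF nz' vs es that] by (simp add: cycle_intersection_matrix_uminus[OF carrier])
    show "length zs + card V = card E + 1" by (rule cycle_space_dimension[OF basis])
  qed
  \<comment> \<open>Together with the total number \<open>length ys\<close> of eigenvalues, fixed by
    the dimension formula, the two sums determine all three numbers.\<close>
  show ?thesis
    unfolding mat_index_def
    using sums[OF ys(1)] sums[OF ys(2)] n_pos_laplacian_eq[OF nz vs es ys(1)] n_pos_laplacian_eq[OF nz vs es ys(2)]
    by simp
qed

section \<open>Bridges, negative edges and stable Laplacians\<close>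

lemma Tree_edges_bridge:
  assumes "e \<in> Tree_edges V E"
  shows "e \<in> E" and "\<not> graph_connected V (E - {e})"
proof -
  show e: "e \<in> E" using assms by (simp add: Tree_edges_def)
  show "\<not> graph_connected V (E - {e})"
  proof
    \<comment> \<open>A minimal connected subset would be a spanning tree that avoids
      \<open>e\<close>.\<close>
    assume "graph_connected V (E - {e})"
    then obtain T where T: "T \<subseteq> E - {e}" "graph_connected V T" "\<And>e. e \<in> T \<Longrightarrow> \<not> graph_connected V (T - {e})"
      using connected_minimal_subset[of "E - {e}" V] finite_E by blast
    then have "spanning_tree_edges V E T"
      using minimal_connected_graph_tree unfolding spanning_tree_edges_def by blast
    then show False using assms T(1) unfolding Tree_edges_def by blast
  qed
qed

text \<open>The gradients of the bridge functions of these edges are unit vectors of R^E, so the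
  form is negative definite on a space whose dimension is the number of negative edges in
  \<open>Tree_edges V E\<close>.\<close>

lemma n_pos_laplacian_ge_Tree_edges:
  assumes vs: "enumerates vs V"
  shows "card {e \<in> Tree_edges V E. \<gamma> e < 0} \<le> n_pos (laplacian vs E \<gamma>)"
proof -
  let ?n = "length vs" and ?T = "{e \<in> Tree_edges V E. \<gamma> e < 0}"
  obtain d and u :: "nat \<Rightarrow> 'v \<Rightarrow> real" where du:
    "\<And>P. eigenvalue_count P (laplacian vs E \<gamma>) = card {k. k < ?n \<and> P (d k)}"
    "\<And>c. (\<Sum>e\<in>E. \<gamma> e * (grad ori (\<lambda>v. \<Sum>k<?n. c k * u k v) e)\<^sup>2) = - (\<Sum>k<?n. d k * (c k)\<^sup>2)"
    "\<And>c. (\<forall>v\<in>V. (\<Sum>k<?n. c k * u k v) = 0) \<Longrightarrow> \<forall>k<?n. c k = 0"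
    "\<And>w. \<exists>c. \<forall>v\<in>V. w v = (\<Sum>k<?n. c k * u k v)"
    by (rule laplacian_inertia[OF vs, of \<gamma>]) (rule that)
  have TE: "?T \<subseteq> E" using Tree_edges_bridge by blast
  then have fT: "finite ?T" using finite_E finite_subset by blast
  have "\<exists>s. grad ori s e = 1 \<and> (\<forall>e'\<in>E. e' \<noteq> e \<longrightarrow> grad ori s e' = 0)" if "e \<in> ?T" for e
    using bridge_function[OF order_refl conn, of e] Tree_edges_bridge[of e] that by (metis mem_Collect_eq)
  then have "\<exists>s. \<forall>e\<in>?T. grad ori (s e) e = 1 \<and> (\<forall>e'\<in>E. e' \<noteq> e \<longrightarrow> grad ori (s e) e' = 0)"
    by (intro bchoice ballI)
  then obtain s where "\<forall>e\<in>?T. grad ori (s e) e = 1 \<and> (\<forall>e'\<in>E. e' \<noteq> e \<longrightarrow> grad ori (s e) e' = 0)" ..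
  then have s: "\<And>e. e \<in> ?T \<Longrightarrow> grad ori (s e) e = 1"
    "\<And>e e'. e \<in> ?T \<Longrightarrow> e' \<in> E \<Longrightarrow> e' \<noteq> e \<Longrightarrow> grad ori (s e) e' = 0" by simp_all
  let ?A = "{k. k < ?n \<and> 0 < d k}" and ?A' = "{k. k < ?n \<and> d k \<le> 0}"
  have "card ?T \<le> card ?A"
  proof (rule ccontr)
    assume "\<not> card ?T \<le> card ?A"
    moreover have "card ?A + card ?A' = ?n"
    proof -
      have "card ?A + card ?A' = card (?A \<union> ?A')" by (rule card_Un_disjoint[symmetric]) auto
      also have "?A \<union> ?A' = {..<?n}" by auto
      finally show ?thesis by simp
    qed
    ultimately have less: "card V < card ?A' + card ?T" using enumerates_length[OF vs] by linarith
    have sub: "?A' \<subseteq> {..<?n}" by auto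
    \<comment> \<open>A solution exhibits one function, up to sign, in two ways: as a combination of
      eigenvectors with \<open>d \<le> 0\<close>, where the form is nonnegative, and as a
      combination of bridge functions, where it is negative unless all coefficients are
      zero.\<close>
    obtain c g where c0: "\<And>i. i \<notin> ?A' \<Longrightarrow> c i = 0" and g0: "\<And>k. k \<notin> ?T \<Longrightarrow> g k = 0"
      and cg: "(\<exists>i\<in>?A'. c i \<noteq> 0) \<or> (\<exists>k\<in>?T. g k \<noteq> 0)"
      and sol: "\<And>v. v \<in> V \<Longrightarrow> (\<Sum>i<?n. c i * u i v) + (\<Sum>e\<in>?T. g e * s e v) = 0"
      by (rule homogeneous_system_supported_solution2[OF finite_V finite_lessThan fT sub order_refl less,
            of "\<lambda>v k. u k v" "\<lambda>v e. s e v"]) (rule that)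
    let ?w = "\<lambda>v. \<Sum>i<?n. c i * u i v"
    have grad_w: "grad ori ?w e = - g e" if e: "e \<in> E" for e
    proof -
      have "grad ori ?w e = grad ori (\<lambda>v. - (\<Sum>e\<in>?T. g e * s e v)) e"
        using sol ori_ends[OF e] by (simp add: grad_def add_eq_0_iff)
      also have "\<dots> = - (\<Sum>e'\<in>?T. g e' * grad ori (s e') e)"
        by (simp add: grad_sum[symmetric]) (simp add: grad_def)
      also have "(\<Sum>e'\<in>?T. g e' * grad ori (s e') e) = (\<Sum>e'\<in>?T. if e' = e then g e else 0)"
        using s e by (intro sum.cong refl) auto
      also have "\<dots> = g e" using fT g0[of e] by auto
      finally show ?thesis .
    qed
    have g_nonneg: "0 \<le> - (\<gamma> e * (g e)\<^sup>2)" for e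
      using g0[of e] by (cases "e \<in> ?T") (auto simp: mult_nonpos_nonneg)
    have c_nonneg: "0 \<le> - (d k * (c k)\<^sup>2)" for k
      using c0[of k] by (cases "k \<in> ?A'") (auto simp: mult_nonpos_nonneg)
    have "(\<Sum>e\<in>E. \<gamma> e * (g e)\<^sup>2) = (\<Sum>e\<in>E. \<gamma> e * (grad ori ?w e)\<^sup>2)"
      by (intro sum.cong refl) (simp add: grad_w)
    also have "\<dots> = (\<Sum>k<?n. - (d k * (c k)\<^sup>2))" unfolding du(2) by (simp add: sum_negf)
    also have "\<dots> \<ge> 0" by (intro sum_nonneg c_nonneg)
    finally have "(\<Sum>e\<in>E. - (\<gamma> e * (g e)\<^sup>2)) \<le> 0" by (simp add: sum_negf)
    moreover have "0 \<le> (\<Sum>e\<in>E. - (\<gamma> e * (g e)\<^sup>2))" by (intro sum_nonneg g_nonneg)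
    ultimately have "(\<Sum>e\<in>E. - (\<gamma> e * (g e)\<^sup>2)) = 0" by simp
    then have \<gamma>g: "\<forall>e\<in>E. - (\<gamma> e * (g e)\<^sup>2) = 0"
      using g_nonneg finite_E by (subst (asm) sum_nonneg_eq_0_iff) auto
    have g: "g e = 0" for e using g0[of e] bspec[OF \<gamma>g, of e] Tree_edges_bridge(1)[of e] by (cases "e \<in> ?T") auto
    then have "\<forall>v\<in>V. ?w v = 0" using sol by simp
    then have "\<forall>k<?n. c k = 0" by (rule du(3))
    then show False using cg g by auto
  qed
  then show ?thesis unfolding n_pos_def du(1) .
qed

lemma stable_positive_connected:
  assumes vs: "enumerates vs V" and stable: "laplacian_stable vs E \<delta>" and nz: "\<forall>e\<in>E. \<delta> e \<noteq> 0"
  shows "graph_connected V (E - negative_edges E \<delta>)"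
proof (rule ccontr)
  assume "\<not> graph_connected V (E - negative_edges E \<delta>)"
  then obtain s where s: "\<And>e. e \<in> E - negative_edges E \<delta> \<Longrightarrow> grad ori s e = 0" "\<exists>e\<in>E. grad ori s e \<noteq> 0"
    using cut_function[of "E - negative_edges E \<delta>"] by blast
  have nonpos: "0 \<le> - (\<delta> e * (grad ori s e)\<^sup>2)" if "e \<in> E" for e
    using that s(1)[of e] by (cases "e \<in> negative_edges E \<delta>") (auto simp: negative_edges_def mult_nonpos_nonneg)
  have "0 \<le> (\<Sum>e\<in>E. \<delta> e * (grad ori s e)\<^sup>2)" using stable laplacian_stable_iff[OF vs] by blast
  then have "(\<Sum>e\<in>E. - (\<delta> e * (grad ori s e)\<^sup>2)) \<le> 0" by (simp add: sum_negf)
  moreover have "0 \<le> (\<Sum>e\<in>E. - (\<delta> e * (grad ori s e)\<^sup>2))" by (intro sum_nonneg nonpos)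
  ultimately have "(\<Sum>e\<in>E. - (\<delta> e * (grad ori s e)\<^sup>2)) = 0" by simp
  then have "\<forall>e\<in>E. - (\<delta> e * (grad ori s e)\<^sup>2) = 0"
    using nonpos finite_E by (subst (asm) sum_nonneg_eq_0_iff) auto
  then show False using s(2) nz by auto
qed

lemma card_negative_edges_add:
  "card (negative_edges E \<delta>) + card (E - negative_edges E \<delta>) = card E"
  using finite_E card_Diff_subset[of "negative_edges E \<delta>" E] card_mono[of E "negative_edges E \<delta>"]
    finite_subset[of "negative_edges E \<delta>" E]
  by (auto simp: negative_edges_def)

text \<open>The edges that are not negative still connect \<open>V\<close>, so there are at least
  \<open>card V - 1\<close> of them.\<close>

lemma stable_card_negative_edges_le:
  assumes "enumerates vs V" and "laplacian_stable vs E \<delta>" and "\<forall>e\<in>E. \<delta> e \<noteq> 0"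
  shows "card (negative_edges E \<delta>) \<le> cycle_number V E"
  using card_V_le_connected[OF Diff_subset stable_positive_connected[OF assms]] card_negative_edges_add[of \<delta>]
  unfolding cycle_number_def by linarith

lemma stable_weights_exist:
  assumes vs: "enumerates vs V"
  shows "\<exists>\<delta>. (\<forall>e\<in>E. \<delta> e \<noteq> 0) \<and> laplacian_stable vs E \<delta> \<and> card (negative_edges E \<delta>) = cycle_number V E"
proof -
  obtain T where T: "T \<subseteq> E" "graph_connected V T" "\<And>e. e \<in> T \<Longrightarrow> \<not> graph_connected V (T - {e})"
    using connected_minimal_subset[OF finite_E conn] by blast
  have fT: "finite T" using T finite_E finite_subset by blast
  let ?S = "\<lambda>w. \<Sum>e\<in>T. (grad ori w e)\<^sup>2"
  have "\<exists>K\<ge>0. \<forall>w. (grad ori w e)\<^sup>2 \<le> K * ?S w" if "e \<in> E" for e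
  proof -
    have "(fst (ori e), snd (ori e)) \<in> (edge_rel T)\<^sup>*"
      using T(2) ori_ends[OF that] unfolding graph_connected_def by blast
    from grad_path_bound[OF T(1) this] show ?thesis unfolding grad_def .
  qed
  then obtain K where K: "\<And>e. e \<in> E \<Longrightarrow> 0 \<le> K e" "\<And>e w. e \<in> E \<Longrightarrow> (grad ori w e)\<^sup>2 \<le> K e * ?S w" by metis
  \<comment> \<open>The sum of the \<open>K e\<close> pays for the edges of weight -1 outside the
    tree; the summand 1 keeps the tree weights positive even if this sum is zero.\<close>
  define \<delta> where "\<delta> e = (if e \<in> T then 1 + (\<Sum>e\<in>E - T. K e) else - 1)" for e
  have K0: "0 \<le> (\<Sum>e\<in>E - T. K e)" using K(1) by (intro sum_nonneg) auto
  have "0 \<le> (\<Sum>e\<in>E. \<delta> e * (grad ori w e)\<^sup>2)" for w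
  proof -
    have "(\<Sum>e\<in>E - T. (grad ori w e)\<^sup>2) \<le> (\<Sum>e\<in>E - T. K e * ?S w)" using K(2) by (intro sum_mono) auto
    also have "\<dots> = (\<Sum>e\<in>E - T. K e) * ?S w" by (simp only: sum_distrib_right)
    finally have 1: "(\<Sum>e\<in>E - T. (grad ori w e)\<^sup>2) \<le> (\<Sum>e\<in>E - T. K e) * ?S w" .
    have "(\<Sum>e\<in>E. \<delta> e * (grad ori w e)\<^sup>2)
      = (\<Sum>e\<in>E - T. \<delta> e * (grad ori w e)\<^sup>2) + (\<Sum>e\<in>T. \<delta> e * (grad ori w e)\<^sup>2)"
      by (rule sum.subset_diff[OF T(1) finite_E])
    also have "(\<Sum>e\<in>E - T. \<delta> e * (grad ori w e)\<^sup>2) = - (\<Sum>e\<in>E - T. (grad ori w e)\<^sup>2)"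
      unfolding sum_negf[symmetric] by (intro sum.cong refl) (auto simp: \<delta>_def)
    also have "(\<Sum>e\<in>T. \<delta> e * (grad ori w e)\<^sup>2) = (1 + (\<Sum>e\<in>E - T. K e)) * ?S w"
      unfolding sum_distrib_left by (intro sum.cong refl) (auto simp: \<delta>_def)
    finally have "(\<Sum>e\<in>E. \<delta> e * (grad ori w e)\<^sup>2)
      = - (\<Sum>e\<in>E - T. (grad ori w e)\<^sup>2) + (1 + (\<Sum>e\<in>E - T. K e)) * ?S w" .
    moreover have "0 \<le> ?S w" by (intro sum_nonneg) simp
    ultimately show ?thesis using 1 by (simp add: distrib_right)
  qed
  then have "laplacian_stable vs E \<delta>" using laplacian_stable_iff[OF vs] by blast
  moreover have "negative_edges E \<delta> = E - T" using K0 by (auto simp: negative_edges_def \<delta>_def)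
  then have "card (negative_edges E \<delta>) = cycle_number V E"
    using card_minimal_connected[OF T] card_Diff_subset[OF fT T(1)] card_mono[OF finite_E T(1)]
    by (simp add: cycle_number_def)
  moreover have "\<forall>e\<in>E. \<delta> e \<noteq> 0" using K0 by (auto simp: \<delta>_def)
  ultimately show ?thesis by blast
qed

text \<open>The positive edges connect \<open>V\<close> and are just numerous enough for a spanning
  tree. The basis consists of the fundamental cycles of the negative edges with respect to that
  tree.\<close>

lemma maximal_stable_structure:
  assumes vs: "enumerates vs V" and es: "enumerates es E" and nz: "\<forall>e\<in>E. \<gamma> e \<noteq> 0"
    and stable: "laplacian_stable vs E \<gamma>" and card: "card (negative_edges E \<gamma>) = cycle_number V E"
  shows "\<exists>cs. (\<forall>c\<in>set cs. graph_cycle V E c \<and> card (cycle_edges c \<inter> negative_edges E \<gamma>) = 1)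
      \<and> cycle_space_basis vs es ori (map (cycle_vector es ori) cs)"
    and "graph_tree V (E - negative_edges E \<gamma>)"
proof -
  let ?N = "negative_edges E \<gamma>"
  define T where "T = E - ?N"
  have TE: "T \<subseteq> E" "?N \<subseteq> E" "T \<inter> ?N = {}" "T \<union> ?N = E" by (auto simp: T_def negative_edges_def)
  have fin: "finite T" "finite ?N" using TE finite_E finite_subset by blast+
  have connT: "graph_connected V T" unfolding T_def by (rule stable_positive_connected[OF vs stable nz])
  have cardT: "card T + 1 = card V"
    using card card_negative_edges_add[of \<gamma>] card_V_le_connected[OF order_refl conn]
    unfolding cycle_number_def T_def[symmetric] by linarith
  \<comment> \<open>\<open>T\<close> has \<open>card V - 1\<close> edges, the least number that can
    connect \<open>V\<close>.\<close>
  have bridge: "\<not> graph_connected V (T - {e})" if "e \<in> T" for e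
  proof
    assume "graph_connected V (T - {e})"
    then have "card V \<le> card (T - {e}) + 1" using TE by (intro card_V_le_connected) auto
    then show False using cardT that fin card_Suc_Diff1[OF fin(1) that] by linarith
  qed
  show "graph_tree V (E - ?N)"
    using minimal_connected_graph_tree[OF connT bridge] unfolding T_def by blast
  have "\<exists>c. graph_cycle V E c \<and> cycle_edges c \<subseteq> insert e T \<and> e \<in> cycle_edges c" if "e \<in> ?N" for e
    using fundamental_cycle[OF TE(1) connT, of e] that TE by (metis disjoint_iff subsetD)
  then obtain F where F: "\<And>e. e \<in> ?N \<Longrightarrow> graph_cycle V E (F e)"
    "\<And>e. e \<in> ?N \<Longrightarrow> cycle_edges (F e) \<subseteq> insert e T" "\<And>e. e \<in> ?N \<Longrightarrow> e \<in> cycle_edges (F e)"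
    by metis
  obtain ns where ns: "set ns = ?N" "distinct ns" using finite_distinct_list[OF fin(2)] by blast
  let ?cs = "map F ns" and ?C = "length ns"
  have nsN: "ns ! k \<in> ?N" if "k < ?C" for k using nth_mem[OF that] ns(1) by simp
  have "card (cycle_edges c \<inter> ?N) = 1" if c: "c \<in> set ?cs" for c
  proof -
    obtain e where e: "e \<in> ?N" "c = F e" using c ns by auto
    then have "cycle_edges c \<inter> ?N = {e}" using F TE by blast
    then show ?thesis by simp
  qed
  then have cycles: "\<forall>c\<in>set ?cs. graph_cycle V E c \<and> card (cycle_edges c \<inter> ?N) = 1"
    using F(1) ns by auto
  define y where "y k = cycle_fun (F (ns ! k))" for k
  have y_orth: "(\<Sum>e\<in>E. grad ori w e * y k e) = 0" if "k < ?C" for k w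
    unfolding y_def using cycle_fun_orthogonal_grad[OF F(1)[OF nsN[OF that]]] .
  \<comment> \<open>Restricted to the negative edges, the cycles form a diagonal matrix with nonzero
    diagonal; independence and the choice of coefficients both come from this.\<close>
  have y_diag: "y k (ns ! j) = 0 \<longleftrightarrow> j \<noteq> k" if "k < ?C" "j < ?C" for j k
  proof -
    have jE: "ns ! j \<in> E" "ns ! j \<notin> T" using nsN[OF that(2)] by (auto simp: T_def negative_edges_def)
    have "ns ! j \<in> cycle_edges (F (ns ! k)) \<longleftrightarrow> ns ! j = ns ! k"
    proof
      assume "ns ! j \<in> cycle_edges (F (ns ! k))"
      then have "ns ! j \<in> insert (ns ! k) T" by (rule subsetD[OF F(2)[OF nsN[OF that(1)]]])
      then show "ns ! j = ns ! k" using jE by simp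
    qed (simp add: F(3)[OF nsN[OF that(1)]])
    then show ?thesis
      unfolding y_def cycle_fun_eq_0[OF jE(1)] using that ns(2) by (simp add: nth_eq_iff_index_eq)
  qed
  have eval: "(\<Sum>k<?C. c k * y k (ns ! j)) = c j * y j (ns ! j)" if "j < ?C" for c j
  proof -
    have "(\<Sum>k<?C. c k * y k (ns ! j)) = (\<Sum>k<?C. if k = j then c j * y j (ns ! j) else 0)"
      using y_diag that by (intro sum.cong refl) auto
    then show ?thesis using that by simp
  qed
  have "cycle_fun_basis ?C y"
    unfolding cycle_fun_basis_def
  proof (intro conjI allI impI)
    show "(\<Sum>e\<in>E. grad ori w e * y k e) = 0" if "k < ?C" for k w by (rule y_orth[OF that])
    show "c j = 0" if 0: "\<forall>e\<in>E. (\<Sum>k<?C. c k * y k e) = 0" and j: "j < ?C" for c j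
    proof -
      have "c j * y j (ns ! j) = 0" using 0 nsN[OF j] TE eval[OF j, of c] by auto
      then show ?thesis using y_diag[OF j j] by simp
    qed
    fix x assume x: "\<forall>w. (\<Sum>e\<in>E. grad ori w e * x e) = 0"
    \<comment> \<open>The diagonal value \<open>y k (ns ! k)\<close> is 1 or -1 and so its own
      inverse; this choice makes the remainder \<open>r\<close> vanish on every negative
      edge.\<close>
    define c where "c k = x (ns ! k) * y k (ns ! k)" for k
    define r where "r e = x e - (\<Sum>k<?C. c k * y k e)" for e
    have r_orth: "(\<Sum>e\<in>E. grad ori w e * r e) = 0" for w
    proof -
      have "(\<Sum>e\<in>E. grad ori w e * (\<Sum>k<?C. c k * y k e)) = (\<Sum>k<?C. c k * (\<Sum>e\<in>E. grad ori w e * y k e))"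
        unfolding sum_distrib_left by (subst sum.swap) (simp only: mult.left_commute)
      also have "\<dots> = 0" using y_orth by simp
      finally show ?thesis using x unfolding r_def by (simp add: right_diff_distrib sum_subtractf)
    qed
    have rN: "r e = 0" if "e \<in> ?N" for e
    proof -
      obtain j where j: "j < ?C" "e = ns ! j" using \<open>e \<in> ?N\<close> ns(1) by (metis in_set_conv_nth)
      have "y j (ns ! j) * y j (ns ! j) = 1"
        using y_diag[OF j(1) j(1)] cycle_fun_sq unfolding y_def by blast
      then have "c j * y j (ns ! j) = x (ns ! j)" by (simp add: c_def mult.assoc)
      then show ?thesis unfolding r_def j(2) eval[OF j(1)] by simp
    qed
    \<comment> \<open>The gradient of the bridge function of \<open>e\<close> is concentrated at
      \<open>e\<close> within \<open>T\<close>, and \<open>r\<close> is zero off \<open>T\<close>,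
      so orthogonality to this gradient reads off \<open>r e\<close>.\<close>
    have rT: "r e = 0" if e: "e \<in> T" for e
    proof -
      obtain s where s: "grad ori s e = 1" "\<And>e'. e' \<in> T \<Longrightarrow> e' \<noteq> e \<Longrightarrow> grad ori s e' = 0"
        using bridge_function[OF TE(1) connT e bridge[OF e]] by blast
      have "(\<Sum>e'\<in>E. grad ori s e' * r e') = (\<Sum>e'\<in>E. if e' = e then r e else 0)"
      proof (rule sum.cong[OF refl])
        fix e' assume "e' \<in> E"
        then have "e' \<in> T \<or> e' \<in> ?N" using TE(4) by blast
        then show "grad ori s e' * r e' = (if e' = e then r e else 0)" using s rN[of e'] by auto
      qed
      also have "\<dots> = r e" using e TE finite_E by auto
      finally show ?thesis using r_orth by simp
    qed
    have "\<forall>e\<in>E. x e = (\<Sum>k<?C. c k * y k e)" using rN rT TE(4) unfolding r_def by force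
    then show "\<exists>c. \<forall>e\<in>E. x e = (\<Sum>k<?C. c k * y k e)" by (intro exI[of _ c])
  qed
  moreover have "map (cycle_vector es ori) ?cs ! k $ index_of es e = y k e" if k: "k < ?C" and e: "e \<in> E" for k e
  proof -
    obtain l where l: "l < length es" "e = es ! l" using e es by (auto simp: enumerates_def in_set_conv_nth)
    moreover have "index_of es e = l" using l es by (simp add: index_of_nth enumerates_def)
    ultimately show ?thesis using k by (simp add: cycle_vector_def y_def cycle_fun_def)
  qed
  ultimately have "cycle_fun_basis ?C (\<lambda>k e. map (cycle_vector es ori) ?cs ! k $ index_of es e)"
    unfolding cycle_fun_basis_def by simp
  then have "cycle_space_basis vs es ori (map (cycle_vector es ori) ?cs)"
    by (subst cycle_space_basis_iff[OF vs es]) (auto simp: cycle_vector_def)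
  with cycles show "\<exists>cs. (\<forall>c\<in>set cs. graph_cycle V E c \<and> card (cycle_edges c \<inter> ?N) = 1)
      \<and> cycle_space_basis vs es ori (map (cycle_vector es ori) cs)" by blast
qed

end

theorem theorem2p6:
  fixes V :: "'v set" and E :: "'v set set" and \<gamma> :: "'v set \<Rightarrow> real"
    and vs :: "'v list" and es :: "'v set list" and ori :: "'v set \<Rightarrow> 'v \<times> 'v"
  assumes "simple_graph V E"
    and "graph_connected V E"
    and "\<forall>e\<in>E. \<gamma> e \<noteq> 0"
    and "enumerates vs V"
    and "enumerates es E"
    and "orientation E ori"
  shows
    "(\<forall>ys. cycle_space_basis vs es ori ys \<longrightarrow>
        int (n_pos (laplacian vs E \<gamma>))
          = int (card (negative_edges E \<gamma>))
            - int (n_pos (cycle_intersection_matrix es \<gamma> ys))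
            - int (n_zero (cycle_intersection_matrix es \<gamma> ys))
      \<and> (n_zero (cycle_intersection_matrix es \<gamma> ys) = 0 \<longrightarrow>
          int (n_pos (laplacian vs E \<gamma>))
            = int (card (negative_edges E \<gamma>))
              - int (n_pos (cycle_intersection_matrix es \<gamma> ys))))
   \<and> (\<forall>ys ys'. cycle_space_basis vs es ori ys \<and> cycle_space_basis vs es ori ys' \<longrightarrow>
        mat_index (cycle_intersection_matrix es \<gamma> ys)
          = mat_index (cycle_intersection_matrix es \<gamma> ys'))
   \<and> n_pos (laplacian vs E \<gamma>) \<ge> card {e \<in> Tree_edges V E. \<gamma> e < 0}
   \<and> ((\<exists>\<delta>. (\<forall>e\<in>E. \<delta> e \<noteq> 0) \<and> laplacian_stable vs E \<delta> \<and> card (negative_edges E \<delta>) = cycle_number V E)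
      \<and> (\<forall>\<delta>. (\<forall>e\<in>E. \<delta> e \<noteq> 0) \<and> laplacian_stable vs E \<delta>
              \<longrightarrow> card (negative_edges E \<delta>) \<le> cycle_number V E))
   \<and> (laplacian_stable vs E \<gamma> \<and> card (negative_edges E \<gamma>) = cycle_number V E \<longrightarrow>
        (\<exists>cs. (\<forall>c\<in>set cs. graph_cycle V E c \<and> card (cycle_edges c \<inter> negative_edges E \<gamma>) = 1)
            \<and> cycle_space_basis vs es ori (map (cycle_vector es ori) cs))
      \<and> graph_tree V (E - negative_edges E \<gamma>))"
proof -
  interpret connected_graph V E ori
    using assms(1,2,6) by unfold_locales
  note nz = assms(3) and vs = assms(4) and es = assms(5)
  show ?thesis
  proof (intro conjI allI impI)
    fix ys assume ys: "cycle_space_basis vs es ori ys"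
    show "int (n_pos (laplacian vs E \<gamma>))
          = int (card (negative_edges E \<gamma>))
            - int (n_pos (cycle_intersection_matrix es \<gamma> ys))
            - int (n_zero (cycle_intersection_matrix es \<gamma> ys))"
      using n_pos_laplacian_eq[OF nz vs es ys] by simp
    show "int (n_pos (laplacian vs E \<gamma>))
            = int (card (negative_edges E \<gamma>))
              - int (n_pos (cycle_intersection_matrix es \<gamma> ys))"
      if "n_zero (cycle_intersection_matrix es \<gamma> ys) = 0"
      using n_pos_laplacian_eq[OF nz vs es ys] that by simp
  next
    show "mat_index (cycle_intersection_matrix es \<gamma> ys) = mat_index (cycle_intersection_matrix es \<gamma> ys')"
      if "cycle_space_basis vs es ori ys \<and> cycle_space_basis vs es ori ys'" for ys ys'
      using that mat_index_basis_independent[OF nz vs es] by blast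
    show "card {e \<in> Tree_edges V E. \<gamma> e < 0} \<le> n_pos (laplacian vs E \<gamma>)"
      by (rule n_pos_laplacian_ge_Tree_edges[OF vs])
    show "\<exists>\<delta>. (\<forall>e\<in>E. \<delta> e \<noteq> 0) \<and> laplacian_stable vs E \<delta> \<and> card (negative_edges E \<delta>) = cycle_number V E"
      by (rule stable_weights_exist[OF vs])
    show "card (negative_edges E \<delta>) \<le> cycle_number V E"
      if "(\<forall>e\<in>E. \<delta> e \<noteq> 0) \<and> laplacian_stable vs E \<delta>" for \<delta>
      using that stable_card_negative_edges_le[OF vs] by blast
  qed (use maximal_stable_structure[OF vs es nz] in blast)+
qed

end
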